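(* Let $p\in(0,1)$, and let $(\mathcal{G}_x)_{x\in\mathbb{Z}^2}$ be i.i.d. with $\mathcal{G}_x=\{e_1,-e_1\}$ with probability $p$ and $\mathcal{G}_x=\{e_2\}$ with probability $1-p$. Then the random walk $(X_n)$ in the associated uniform random environment, started at the origin, satisfies $P(n^{-1}X_n\to v)=1$ with $$v=\Big(0,\ \frac{(1-p)^2}{p+(1-p)^2}\Big).$$
   Context: $e_1=(1,0)$ and $e_2=(0,1)$ are the unit vectors of $\mathbb{Z}^2$. Given a realization of the i.i.d. non-empty sets $(\mathcal{G}_x)_{x\in\mathbb{Z}^2}$, each a subset of $\{\pm e_1,\pm e_2\}$, the walk in the associated uniform random environment is the time-homogeneous Markov chain $(X_n)_{n\ge0}$ on $\mathbb{Z}^2$ with $X_0=0$ that moves from $x$ to $x+e$ with probability $1/|\mathcal{G}_x|$ if $e\in\mathcal{G}_x$, and with probability $0$ otherwise. The environment is sampled once and kept fixed. $P$ denotes the annealed law, i.e. the law of the walk averaged over the environment. *)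

theory Defs
  imports "HOL-Probability.Probability"
begin

section \<open>Time-homogeneous Markov chains on path space\<close>

definition chain_kernel :: "('a \<Rightarrow> 'a pmf) \<Rightarrow> 'a \<Rightarrow> nat \<Rightarrow> (nat \<Rightarrow> 'a) \<Rightarrow> 'a measure" where
  "chain_kernel K x0 n h =
     (case n of 0 \<Rightarrow> return (count_space UNIV) x0 | Suc m \<Rightarrow> measure_pmf (K (h m)))"

lemma Ionescu_Tulcea_chain_kernel:
  fixes K :: "'a \<Rightarrow> 'a pmf"
  shows "Ionescu_Tulcea (chain_kernel K x0) (\<lambda>_. count_space UNIV)"
proof (rule Ionescu_Tulcea.intro)
  fix i
  show "chain_kernel K x0 i \<in> PiM {0..<i} (\<lambda>_. count_space UNIV) \<rightarrow>\<^sub>M subprob_algebra (count_space UNIV)"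
  proof (cases i)
    case 0
    then show ?thesis
      by (auto simp: chain_kernel_def[abs_def] space_subprob_algebra
               intro!: measurable_const prob_space_imp_subprob_space prob_space_return)
  next
    case (Suc m)
    have "(\<lambda>h. h m) \<in> PiM {0..<i} (\<lambda>_. count_space UNIV) \<rightarrow>\<^sub>M count_space (UNIV :: 'a set)"
      using Suc by (intro measurable_component_singleton) auto
    moreover have "(\<lambda>a. measure_pmf (K a)) \<in> count_space UNIV \<rightarrow>\<^sub>M subprob_algebra (count_space UNIV)"
      by (auto simp: space_subprob_algebra intro!: prob_space_imp_subprob_space measure_pmf.prob_space_axioms)
    ultimately have "(\<lambda>h. measure_pmf (K (h m))) \<in> PiM {0..<i} (\<lambda>_. count_space UNIV) \<rightarrow>\<^sub>M subprob_algebra (count_space UNIV)"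
      by (rule measurable_compose)
    with Suc show ?thesis
      by (simp add: chain_kernel_def[abs_def])
  qed
next
  fix i and h :: "nat \<Rightarrow> 'a"
  show "prob_space (chain_kernel K x0 i h)"
    by (auto simp: chain_kernel_def prob_space_return measure_pmf.prob_space_axioms split: nat.split)
qed

interpretation chain: Ionescu_Tulcea "chain_kernel K x0" "\<lambda>_. count_space UNIV"
  for K :: "'a \<Rightarrow> 'a pmf" and x0 :: 'a
  by (rule Ionescu_Tulcea_chain_kernel)

abbreviation path_space :: "(nat \<Rightarrow> 'a) measure" where
  "path_space \<equiv> PiM UNIV (\<lambda>_. count_space UNIV)"

text \<open>The law on path space of the Markov chain with transition function \<open>K\<close> started at \<open>x0\<close>,
  obtained from the Ionescu-Tulcea theorem; see \<open>emeasure_chain_law_cylinder\<close> below for its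
  finite-dimensional distributions.\<close>

definition chain_law :: "('a \<Rightarrow> 'a pmf) \<Rightarrow> 'a \<Rightarrow> (nat \<Rightarrow> 'a) measure" where
  "chain_law K x0 = chain.PF.lim K x0"

lemma sets_chain_law [simp, measurable_cong]: "sets (chain_law K x0) = sets path_space"
  by (simp add: chain_law_def)

lemma space_chain_law [simp]: "space (chain_law K x0) = UNIV"
  by (simp add: chain_law_def space_PiM)

lemma sets_cylinder [measurable]: "{X. \<forall>i\<le>n. X i = y i} \<in> sets (path_space :: (nat \<Rightarrow> 'a) measure)"
proof -
  have "{X \<in> space path_space. \<forall>i\<in>{..n}. X i = y i} \<in> sets (path_space :: (nat \<Rightarrow> 'a) measure)"
    by measurable
  then show ?thesis by (simp add: space_PiM Ball_def)
qed

lemma chain_C_singleton: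
  "emeasure (chain.C K x0 0 (Suc n) (\<lambda>_. undefined)) {restrict y {0..<Suc n}} =
     ennreal (indicator {x0} (y 0) * (\<Prod>i<n. pmf (K (y i)) (y (Suc i))))"
proof -
  let ?M = "\<lambda>n. PiM {0..<n} (\<lambda>_. count_space (UNIV::'a set))"
  have single: "{restrict y {0..<n}} \<in> sets (?M n)" for n
  proof -
    have "{restrict y {0..<n}} = (\<Pi>\<^sub>E i\<in>{0..<n}. {y i})"
      by (auto simp: PiE_iff extensional_def restrict_def fun_eq_iff)
    then show ?thesis by (auto intro!: sets_PiM_I_finite)
  qed
  have eP: "emeasure (chain.eP K x0 n \<omega>) {restrict y {0..<Suc n}} =
      emeasure (chain_kernel K x0 n \<omega>) {y n} * indicator {restrict y {0..<n}} \<omega>"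
    if "\<omega> \<in> space (?M n)" for n \<omega>
  proof -
    have ext: "\<omega> \<in> extensional {0..<n}"
      using that by (simp add: space_PiM PiE_iff)
    have "(\<lambda>x. fun_upd \<omega> n x) -` {restrict y {0..<Suc n}} =
        (if \<omega> = restrict y {0..<n} then {y n} else {})"
    proof -
      have upd: "fun_upd \<omega> n x = restrict y {0..<Suc n} \<longleftrightarrow> \<omega> = restrict y {0..<n} \<and> x = y n" for x
      proof
        assume eq: "fun_upd \<omega> n x = restrict y {0..<Suc n}"
        have "\<omega> i = restrict y {0..<n} i" for i
        proof (cases "i < n")
          case True
          then show ?thesis using fun_cong[OF eq, of i] by simp
        next
          case False
          then show ?thesis using extensional_arb[OF ext, of i] by simp
        qed
        then show "\<omega> = restrict y {0..<n} \<and> x = y n"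
          using fun_cong[OF eq, of n] by auto
      next
        assume "\<omega> = restrict y {0..<n} \<and> x = y n"
        then show "fun_upd \<omega> n x = restrict y {0..<Suc n}"
          by (auto simp: fun_eq_iff restrict_def)
      qed
      show ?thesis
        by (rule set_eqI, simp only: vimage_eq singleton_iff upd) simp
    qed
    then show ?thesis
      by (simp only: chain.emeasure_eP[OF that single]) simp
  qed
  have step: "emeasure (chain.C K x0 0 (Suc n) (\<lambda>_. undefined)) {restrict y {0..<Suc n}} =
      emeasure (chain_kernel K x0 n (restrict y {0..<n})) {y n} *
      emeasure (chain.C K x0 0 n (\<lambda>_. undefined)) {restrict y {0..<n}}" for n
  proof -
    let ?C = "chain.C K x0 0 n (\<lambda>_. undefined)"
    have s0: "(\<lambda>_. undefined) \<in> space (?M 0)" by (simp add: space_PiM PiE_iff extensional_def)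
    have setsC: "sets ?C = sets (?M n)" using chain.sets_C[OF s0, of K x0 n] by simp
    have spC: "space ?C = space (?M n)" using setsC by (rule sets_eq_imp_space_eq)
    interpret C: prob_space ?C using chain.prob_space_C[OF s0] .
    have "emeasure (?C \<bind> chain.eP K x0 n) {restrict y {0..<Suc n}} =
        (\<integral>\<^sup>+\<omega>. emeasure (chain.eP K x0 n \<omega>) {restrict y {0..<Suc n}} \<partial>?C)"
      using chain.measurable_eP[of K x0 n] single[of "Suc n"]
      by (intro emeasure_bind[where N="?M (Suc n)"] C.not_empty)
         (auto simp: measurable_cong_sets[OF setsC refl])
    also have "\<dots> = (\<integral>\<^sup>+\<omega>. emeasure (chain_kernel K x0 n (restrict y {0..<n})) {y n} *
        indicator {restrict y {0..<n}} \<omega> \<partial>?C)"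
      by (intro nn_integral_cong) (auto simp: spC eP split: split_indicator)
    also have "\<dots> = emeasure (chain_kernel K x0 n (restrict y {0..<n})) {y n} *
        emeasure ?C {restrict y {0..<n}}"
      using single[of n] by (intro nn_integral_cmult_indicator) (simp add: setsC)
    finally show ?thesis by simp
  qed
  show ?thesis
  proof (induction n)
    case 0
    show ?case
      using single[of 0]
      by (subst step) (simp add: chain_kernel_def indicator_def restrict_def)
  next
    case (Suc n)
    show ?case
      by (subst step, subst Suc.IH)
         (simp add: chain_kernel_def emeasure_pmf_single ennreal_mult'[symmetric] mult_ac)
  qed
qed

theorem emeasure_chain_law_cylinder:
  "emeasure (chain_law K x0) {X. \<forall>i\<le>n. X i = y i} =
     ennreal (indicator {x0} (y 0) * (\<Prod>i<n. pmf (K (y i)) (y (Suc i))))"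
proof -
  let ?M = "\<lambda>J. PiM J (\<lambda>_. count_space (UNIV::'a set))"
  let ?J = "{0..<Suc n}"
  have "{restrict y ?J} = (\<Pi>\<^sub>E i\<in>?J. {y i})"
    by (auto simp: PiE_iff extensional_def restrict_def fun_eq_iff)
  then have single: "{restrict y ?J} \<in> sets (?M ?J)"
    by (auto intro!: sets_PiM_I_finite)
  have cyl: "{X. \<forall>i\<le>n. X i = y i} = prod_emb UNIV (\<lambda>_. count_space UNIV) ?J {restrict y ?J}"
    by (auto simp: prod_emb_def space_PiM restrict_def fun_eq_iff less_Suc_eq_le) metis
  have "prod_emb ?J (\<lambda>_. count_space UNIV) ?J {restrict y ?J} = {restrict y ?J}"
    by (rule prod_emb_id) (auto simp: PiE_iff)
  then have "emeasure (chain_law K x0) {X. \<forall>i\<le>n. X i = y i} =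
      emeasure (chain.C K x0 0 (Suc n) (\<lambda>_. undefined)) {restrict y ?J}"
    unfolding cyl chain_law_def
    by (subst chain.lim[OF _ single], simp, subst chain.emeasure_CI[OF _ single, of "Suc n"]) auto
  then show ?thesis by (simp only: chain_C_singleton)
qed

lemma prob_space_chain_law: "prob_space (chain_law K x0)"
proof
  have "emeasure (chain.PF.lim K x0) (prod_emb UNIV (\<lambda>_. count_space UNIV) {} (space (PiM {} (\<lambda>_. count_space UNIV)))) =
      emeasure (chain.CI K x0 {}) (space (PiM {} (\<lambda>_. count_space UNIV)))"
    by (rule chain.lim) auto
  also have "\<dots> = 1"
    using prob_space.emeasure_space_1[OF chain.PF.prob_space_P[of "{}" K x0]]
    by (simp add: chain.PF.space_P)
  finally show "emeasure (chain_law K x0) (space (chain_law K x0)) = 1"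
    by (simp add: chain_law_def space_PiM prod_emb_def PiE_def vimage_def restrict_def)
qed

lemma sets_path_space_generated:
  fixes G :: "(nat \<Rightarrow> 'a :: countable) set set"
  defines "G \<equiv> insert {} (range (\<lambda>(n, y). {X. \<forall>i\<le>n. X i = y i}))"
  shows "sets (path_space :: (nat \<Rightarrow> 'a) measure) = sigma_sets UNIV G" and "Int_stable G"
proof -
  show "sets (path_space :: (nat \<Rightarrow> 'a) measure) = sigma_sets UNIV G"
  proof (intro antisym)
    show "sigma_sets UNIV G \<subseteq> sets (path_space :: (nat \<Rightarrow> 'a) measure)"
    proof -
      have "G \<subseteq> sets path_space"
        by (auto simp: G_def)
      from sets.sigma_sets_subset[OF this] show ?thesis
        by (simp add: space_PiM)
    qed
    interpret S: sigma_algebra "UNIV :: (nat \<Rightarrow> 'a) set" "sigma_sets UNIV G"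
      by (rule sigma_algebra_sigma_sets) simp
    have gen: "{f. f i \<in> A} \<in> sigma_sets UNIV G" for i and A :: "'a set"
    proof -
      have "{f. f i \<in> A} = (\<Union>ys\<in>{ys. length ys = Suc i \<and> ys ! i \<in> A}. {X. \<forall>j\<le>i. X j = ys ! j})"
      proof safe
        fix f :: "nat \<Rightarrow> 'a" assume "f i \<in> A"
        then show "f \<in> (\<Union>ys\<in>{ys. length ys = Suc i \<and> ys ! i \<in> A}. {X. \<forall>j\<le>i. X j = ys ! j})"
          by (intro UN_I[of "map f [0..<Suc i]"]) (auto simp del: upt_Suc simp: nth_map_upt)
      qed auto
      moreover have "(\<Union>ys\<in>{ys. length ys = Suc i \<and> ys ! i \<in> A}. {X. \<forall>j\<le>i. X j = ys ! j}) \<in> sigma_sets UNIV G"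
        by (rule S.countable_UN'[OF countableI_type]) (auto simp: G_def intro!: sigma_sets.Basic)
      ultimately show ?thesis by simp
    qed
    show "sets (path_space :: (nat \<Rightarrow> 'a) measure) \<subseteq> sigma_sets UNIV G"
      unfolding sets_PiM_single using gen by (auto simp: PiE_def intro!: S.sigma_sets_subset)
  qed
  have "{X. \<forall>i\<le>n. X i = y i} \<inter> {X. \<forall>i\<le>m. X i = z i} \<in> G" for n m and y z :: "nat \<Rightarrow> 'a"
  proof (cases "\<forall>i\<le>min n m. y i = z i")
    case True
    then have "{X. \<forall>i\<le>n. X i = y i} \<inter> {X. \<forall>i\<le>m. X i = z i} =
        {X. \<forall>i\<le>max n m. X i = (if n \<le> m then z else y) i}"
      by (auto simp: max_def min_def split: if_splits)
    then show ?thesis by (auto simp: G_def)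
  next
    case False
    then have "{X. \<forall>i\<le>n. X i = y i} \<inter> {X. \<forall>i\<le>m. X i = z i} = {}"
      by auto
    then show ?thesis by (simp add: G_def)
  qed
  then show "Int_stable G"
    by (auto simp: Int_stable_def G_def)
qed

lemma measurable_chain_law:
  fixes K :: "'w \<Rightarrow> 'a :: countable \<Rightarrow> 'a pmf"
  assumes [measurable]: "\<And>a b. (\<lambda>w. pmf (K w a) b) \<in> borel_measurable M"
  shows "(\<lambda>w. chain_law (K w) x0) \<in> M \<rightarrow>\<^sub>M prob_algebra path_space"
proof (rule measurable_prob_algebra_generated[OF sets_path_space_generated])
  fix A :: "(nat \<Rightarrow> 'a) set"
  assume "A \<in> insert {} (range (\<lambda>(n, y). {X. \<forall>i\<le>n. X i = y i}))"
  then show "(\<lambda>w. emeasure (chain_law (K w) x0) A) \<in> borel_measurable M"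
    by (auto simp: emeasure_chain_law_cylinder)
qed (auto intro: prob_space_chain_law)


section \<open>Random walks in uniform random environments on the square lattice\<close>

definition e1 :: "int \<times> int" where "e1 = (1, 0)"
definition e2 :: "int \<times> int" where "e2 = (0, 1)"

definition jump_sets :: "(int \<times> int) set set" where
  "jump_sets = {A. A \<noteq> {} \<and> A \<subseteq> {e1, - e1, e2, - e2}}"

text \<open>An environment \<open>g\<close> assigns to each site \<open>x\<close> the set \<open>g x\<close> of jumps allowed from \<open>x\<close>.\<close>

definition uniform_step :: "(int \<times> int \<Rightarrow> (int \<times> int) set) \<Rightarrow> int \<times> int \<Rightarrow> (int \<times> int) pmf" where
  "uniform_step g x = map_pmf (\<lambda>e. x + e) (pmf_of_set (g x))"

definition quenched_law :: "(int \<times> int \<Rightarrow> (int \<times> int) set) \<Rightarrow> (nat \<Rightarrow> int \<times> int) measure" where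
  "quenched_law g = chain_law (uniform_step g) 0"

definition iid_environment ::
    "'w measure \<Rightarrow> (int \<times> int \<Rightarrow> 'w \<Rightarrow> (int \<times> int) set) \<Rightarrow> bool" where
  "iid_environment M G \<longleftrightarrow>
     prob_space M \<and>
     prob_space.indep_vars M (\<lambda>_. count_space jump_sets) G UNIV \<and>
     (\<forall>x y. distr M (count_space jump_sets) (G x) = distr M (count_space jump_sets) (G y))"

definition annealed_law ::
    "'w measure \<Rightarrow> (int \<times> int \<Rightarrow> 'w \<Rightarrow> (int \<times> int) set) \<Rightarrow> (nat \<Rightarrow> int \<times> int) measure" where
  "annealed_law M G = M \<bind> (\<lambda>w. quenched_law (\<lambda>x. G x w))"

lemma pmf_uniform_step:
  assumes "g x \<in> jump_sets"
  shows "pmf (uniform_step g x) (x + e) = (if e \<in> g x then 1 / real (card (g x)) else 0)"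
proof -
  have "finite (g x)" "g x \<noteq> {}"
    using assms by (auto simp: jump_sets_def intro: finite_subset)
  moreover have "pmf (uniform_step g x) (x + e) = pmf (pmf_of_set (g x)) e"
    unfolding uniform_step_def by (rule pmf_map_inj') (auto simp: inj_on_def)
  ultimately show ?thesis by (simp add: indicator_def)
qed

lemma iid_environment_measurable:
  "iid_environment M G \<Longrightarrow> G x \<in> M \<rightarrow>\<^sub>M count_space jump_sets"
  using prob_space.indep_vars_def[of M "\<lambda>_. count_space jump_sets" G UNIV]
  by (cases x) (simp add: iid_environment_def)

lemma measurable_quenched_law:
  assumes "iid_environment M G"
  shows "(\<lambda>w. quenched_law (\<lambda>x. G x w)) \<in> M \<rightarrow>\<^sub>M prob_algebra path_space"
  unfolding quenched_law_def
proof (rule measurable_chain_law)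
  fix a b
  show "(\<lambda>w. pmf (uniform_step (\<lambda>x. G x w) a) b) \<in> borel_measurable M"
    unfolding uniform_step_def
    by (rule measurable_compose[OF iid_environment_measurable[OF assms, of a]]) simp
qed

theorem emeasure_annealed_law:
  assumes "iid_environment M G" and "A \<in> sets path_space"
  shows "emeasure (annealed_law M G) A = (\<integral>\<^sup>+w. emeasure (quenched_law (\<lambda>x. G x w)) A \<partial>M)"
proof -
  interpret prob_space M using assms(1) by (simp add: iid_environment_def)
  show ?thesis
    unfolding annealed_law_def
    using measurable_prob_algebraD[OF measurable_quenched_law[OF assms(1)]] assms(2)
    by (intro emeasure_bind not_empty)
qed

lemma
  assumes "iid_environment M G"
  shows sets_annealed_law: "sets (annealed_law M G) = sets path_space"
    and space_annealed_law: "space (annealed_law M G) = UNIV"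
    and prob_space_annealed_law: "prob_space (annealed_law M G)"
proof -
  interpret prob_space M using assms by (simp add: iid_environment_def)
  show 1: "sets (annealed_law M G) = sets path_space"
    unfolding annealed_law_def quenched_law_def by (intro sets_bind not_empty) simp
  from sets_eq_imp_space_eq[OF 1] show 2: "space (annealed_law M G) = UNIV"
    by (simp add: space_PiM)
  show "prob_space (annealed_law M G)"
    unfolding annealed_law_def
    by (rule prob_space_bind'[OF _ measurable_quenched_law[OF assms]])
       (simp add: space_prob_algebra prob_space_axioms)
qed

definition plane :: "int \<times> int \<Rightarrow> real \<times> real" where
  "plane x = (real_of_int (fst x), real_of_int (snd x))"

end

theory Submission
  imports Defs
begin

text \<open>The walk never steps down, so its path splits into excursions, one for each row, and different
  rows use disjoint parts of the environment. Annealed path weights are therefore multiplicative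
  over excursions, i.e. the excursions are i.i.d., and it suffices to apply the strong law of large
  numbers to their durations and to their horizontal displacements. The displacement has mean \<open>0\<close>
  by reflection. If the nearest vertical sites of the row are at distances \<open>a\<close> to the left and \<open>b\<close> to
  the right of the entrance, the quenched mean duration is \<open>1 + a * b\<close> (gambler's ruin). Since \<open>a * b\<close>
  is the number of pairs \<open>(i, j)\<close> such that all sites from \<open>-i\<close> to \<open>j\<close> are horizontal, its mean is
  \<open>\<Sum>i j. p ^ (i + j + 1) = p / (1 - p)\<^sup>2\<close>, and the speed is the reciprocal of \<open>1 + p / (1 - p)\<^sup>2\<close>.\<close>

text \<open>Within a row the walk revisits sites, so under the annealed law it is not Markov and its
  path weights do not factor over single steps. The excursion is the smallest unit that factors, and
  its duration is therefore estimated in a fixed environment and averaged afterwards.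

  The i.i.d. structure is not extracted from the given path by hitting times. It is built on the
  other side: explicit weights define a law on finite words, an i.i.d. sequence of such words is
  decoded into a walk, and the two laws on path space are compared on cylinders. For this the
  weights must have total mass 1, that is, no row may trap the walk. This falls out of the mean
  duration, because the terms of a convergent series tend to 0.

  The law of large numbers is proved for square integrable nonnegative variables, so a second moment
  of the duration is required. In a fixed environment it is controlled by the square of
  \<open>1 + (a + b)^2\<close>, hence by the fourth powers of \<open>a\<close> and \<open>b\<close>,
  whose tails are geometric. The horizontal displacement is signed, so it enters through its sum
  with the duration.\<close>

section \<open>Exit time of simple random walk from an interval\<close>

text \<open>\<open>stay H n x\<close> is the probability that simple random walk from \<open>x\<close> is in \<open>H\<close> at the times \<open>0, \<dots>, n - 1\<close>.\<close>

primrec stay :: "int set \<Rightarrow> nat \<Rightarrow> int \<Rightarrow> real" where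
  "stay H 0 x = 1"
| "stay H (Suc n) x = (if x \<in> H then (stay H n (x + 1) + stay H n (x - 1)) / 2 else 0)"

lemma stay_nonneg: "0 \<le> stay H n x"
  by (induction n arbitrary: x) auto

lemma stay_le_1: "stay H n x \<le> 1"
proof (induction n arbitrary: x)
  case (Suc n)
  from Suc[of "x + 1"] Suc[of "x - 1"] show ?case by auto
qed simp

context
  fixes H :: "int set" and a b :: int
  assumes gap: "{a<..<b} \<subseteq> H" "a \<notin> H" "b \<notin> H"
begin

text \<open>The classical mean exit time \<open>(x - a) * (b - x)\<close> from the interval, plus 1
  for the term \<open>n = 0\<close> of the series in \<open>stay_sums\<close>. In the walk this 1 is
  the vertical step that closes the excursion.\<close>

definition exit_time :: "int \<Rightarrow> real" where
  "exit_time x = 1 + real_of_int (x - a) * real_of_int (b - x)"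

lemma exit_time_le:
  assumes "x \<in> {a..b}"
  shows "1 \<le> exit_time x" "exit_time x \<le> 1 + (real_of_int (b - a))\<^sup>2"
proof -
  have "real_of_int (x - a) * real_of_int (b - x) \<le> real_of_int (b - a) * real_of_int (b - a)"
    using assms by (intro mult_mono) auto
  then show "exit_time x \<le> 1 + (real_of_int (b - a))\<^sup>2"
    by (simp add: exit_time_def power2_eq_square)
  show "1 \<le> exit_time x"
    using assms by (simp add: exit_time_def)
qed

text \<open>First-step equation. The second difference of the quadratic is -2, so averaging over the
  two neighbours loses exactly 1. The only points of the interval outside \<open>H\<close> are the
  endpoints, where the value is 1.\<close>

lemma exit_time_step:
  assumes "x \<in> {a..b}"
  shows "exit_time x = 1 + (if x \<in> H then (exit_time (x + 1) + exit_time (x - 1)) / 2 else 0)"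
proof (cases "x \<in> H")
  case False
  then have "x = a \<or> x = b" using assms gap(1) by (cases "a < x \<and> x < b") auto
  with False show ?thesis by (auto simp: exit_time_def)
next
  case True
  have "real_of_int (x + 1 - a) * real_of_int (b - (x + 1)) + real_of_int (x - 1 - a) * real_of_int (b - (x - 1)) =
      2 * (real_of_int (x - a) * real_of_int (b - x)) - 2"
    by (simp add: algebra_simps)
  with True show ?thesis by (simp add: exit_time_def del: of_int_diff of_int_add)
qed

lemma neighbours_in_gap:
  assumes "x \<in> {a..b}" "x \<in> H"
  shows "x + 1 \<in> {a..b}" "x - 1 \<in> {a..b}"
proof -
  have "x \<noteq> a" "x \<noteq> b" using assms gap by auto
  then show "x + 1 \<in> {a..b}" "x - 1 \<in> {a..b}" using assms(1) by auto
qed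

lemma sum_stay_Suc:
  "(\<Sum>n<Suc N. stay H n x) =
     1 + (if x \<in> H then ((\<Sum>n<N. stay H n (x + 1)) + (\<Sum>n<N. stay H n (x - 1))) / 2 else 0)"
  by (subst sum.lessThan_Suc_shift) (simp add: sum.distrib sum_divide_distrib[symmetric])

lemma sum_stay_le:
  assumes "x \<in> {a..b}"
  shows "(\<Sum>n<N. stay H n x) \<le> exit_time x"
  using assms
proof (induction N arbitrary: x)
  case 0
  then show ?case using exit_time_le(1)[of x] by simp
next
  case (Suc N)
  show ?case
  proof (cases "x \<in> H")
    case True
    then show ?thesis
      using add_mono[OF Suc.IH Suc.IH, OF neighbours_in_gap[OF Suc.prems True]]
      unfolding sum_stay_Suc exit_time_step[OF Suc.prems] by simp
  qed (simp add: exit_time_step[OF Suc.prems] sum_stay_Suc del: sum.lessThan_Suc)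
qed

text \<open>The defect on the left satisfies the same homogeneous first-step recursion as
  \<open>stay\<close>. A bound by a constant at \<open>N = 0\<close> is therefore propagated with
  the factor \<open>stay H N x\<close>.\<close>

lemma sum_stay_ge:
  assumes "x \<in> {a..b}"
  shows "exit_time x - (\<Sum>n<N. stay H n x) \<le> (1 + (real_of_int (b - a))\<^sup>2) * stay H N x"
  using assms
proof (induction N arbitrary: x)
  case 0
  then show ?case using exit_time_le(2)[of x] by simp
next
  case (Suc N)
  let ?C = "1 + (real_of_int (b - a))\<^sup>2"
  show ?case
  proof (cases "x \<in> H")
    case True
    have "exit_time x - (\<Sum>n<Suc N. stay H n x) =
        ((exit_time (x + 1) - (\<Sum>n<N. stay H n (x + 1))) +
         (exit_time (x - 1) - (\<Sum>n<N. stay H n (x - 1)))) / 2"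
      using True unfolding sum_stay_Suc exit_time_step[OF Suc.prems]
      by (simp add: add_divide_distrib diff_divide_distrib)
    also have "\<dots> \<le> (?C * stay H N (x + 1) + ?C * stay H N (x - 1)) / 2"
      using Suc.IH[of "x + 1"] Suc.IH[of "x - 1"] neighbours_in_gap[OF Suc.prems True] by simp
    also have "\<dots> = ?C * stay H (Suc N) x"
      using True by (simp add: distrib_left[symmetric] add_divide_distrib)
    finally show ?thesis .
  next
    case False
    then show ?thesis
      unfolding sum_stay_Suc exit_time_step[OF Suc.prems] by simp
  qed
qed

text \<open>The upper bound on the partial sums gives summability, hence \<open>stay\<close> tends
  to 0, and by \<open>sum_stay_ge\<close> this closes the gap to \<open>exit_time\<close>. No rate
  of decay enters.\<close>

lemma stay_sums:
  assumes "x \<in> {a..b}"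
  shows "(\<lambda>n. stay H n x) sums exit_time x"
proof -
  let ?C = "1 + (real_of_int (b - a))\<^sup>2"
  have "summable (\<lambda>n. stay H n x)"
    by (rule summableI_nonneg_bounded[OF stay_nonneg sum_stay_le[OF assms]])
  then have upper: "(\<lambda>N. ?C * stay H N x) \<longlonglongrightarrow> 0"
    by (intro tendsto_mult_right_zero summable_LIMSEQ_zero)
  have "(\<lambda>N. exit_time x - (\<Sum>n<N. stay H n x)) \<longlonglongrightarrow> 0"
    using sum_stay_le[OF assms] sum_stay_ge[OF assms]
    by (intro tendsto_sandwich[OF _ _ tendsto_const upper] always_eventually allI) simp_all
  from tendsto_diff[OF tendsto_const[of "exit_time x"] this] show ?thesis
    by (simp add: sums_def)
qed

text \<open>Prepares the second moment. Writing \<open>Suc n\<close> as \<open>1 + n\<close> and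
  shifting the index gives a first-step recursion whose source is the unweighted sum. That source is
  at most the constant \<open>?C\<close>, so \<open>?C * exit_time\<close> dominates the
  solution.\<close>

lemma sum_stay_weighted_le:
  assumes "x \<in> {a..b}"
  shows "(\<Sum>n<N. real (Suc n) * stay H n x) \<le> (1 + (real_of_int (b - a))\<^sup>2) * exit_time x"
  using assms
proof (induction N arbitrary: x)
  case 0
  have "0 \<le> exit_time x" using exit_time_le(1)[OF 0] by linarith
  then show ?case by simp
next
  case (Suc N)
  let ?C = "1 + (real_of_int (b - a))\<^sup>2"
  let ?S = "\<lambda>x. \<Sum>n<N. real (Suc n) * stay H n x"
  have "(\<Sum>n<Suc N. real (Suc n) * stay H n x) =
      (\<Sum>n<Suc N. stay H n x) + (\<Sum>n<Suc N. real n * stay H n x)"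
    unfolding sum.distrib[symmetric] by (intro sum.cong) (auto simp: algebra_simps)
  also have "(\<Sum>n<Suc N. real n * stay H n x) = (\<Sum>n<N. real (Suc n) * stay H (Suc n) x)"
    by (subst sum.lessThan_Suc_shift) simp
  also have "\<dots> = (if x \<in> H then (?S (x + 1) + ?S (x - 1)) / 2 else 0)"
    unfolding sum.distrib[symmetric] sum_divide_distrib
    by (cases "x \<in> H") (simp_all add: distrib_left del: of_nat_Suc)
  also have "\<dots> \<le> (if x \<in> H then (?C * exit_time (x + 1) + ?C * exit_time (x - 1)) / 2 else 0)"
    using add_mono[OF Suc.IH[of "x + 1"] Suc.IH[of "x - 1"]] neighbours_in_gap[OF Suc.prems]
    by (cases "x \<in> H") (simp_all del: of_nat_Suc of_int_diff atLeastAtMost_iff)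
  also have "\<dots> = ?C * (exit_time x - 1)"
    using exit_time_step[OF Suc.prems]
    by (cases "x \<in> H") (simp_all add: distrib_left[symmetric] del: of_int_diff)
  also have "(\<Sum>n<Suc N. stay H n x) \<le> ?C"
    using sum_stay_le[OF Suc.prems] exit_time_le(2)[OF Suc.prems] by (rule order_trans)
  also have "?C + ?C * (exit_time x - 1) = ?C * exit_time x"
    by (simp add: right_diff_distrib del: of_int_diff)
  finally show ?case by simp
qed

end

section \<open>A strong law of large numbers for square integrable variables\<close>

text \<open>Monotonicity traps \<open>S n / n\<close> between its values at the neighbouring
  squares, up to the ratio of consecutive squares, which tends to 1.\<close>

lemma average_tendsto_of_square_subsequence:
  fixes S :: "nat \<Rightarrow> real"
  assumes mono: "incseq S" and S0: "0 \<le> S 0"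
    and lim: "(\<lambda>k. S ((Suc k)\<^sup>2) / real ((Suc k)\<^sup>2)) \<longlonglongrightarrow> m"
  shows "(\<lambda>n. S n / real n) \<longlonglongrightarrow> m"
proof -
  \<comment> \<open>The squares are indexed by \<open>Suc k\<close> to avoid dividing by 0. The
    truncated subtraction is exact for \<open>n\<close> at least 1.\<close>
  define k where "k n = nat (floor (sqrt (real n))) - 1" for n
  have k: "(Suc (k n))\<^sup>2 \<le> n" "n \<le> (Suc (Suc (k n)))\<^sup>2" if "1 \<le> n" for n
  proof -
    have "1 \<le> nat (floor (sqrt (real n)))"
      using that by (simp add: le_nat_floor)
    then have eq: "Suc (k n) = nat (floor (sqrt (real n)))" by (simp add: k_def)
    have *: "real (Suc (k n)) \<le> sqrt (real n)" "sqrt (real n) \<le> real (Suc (Suc (k n)))"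
    proof -
      have "real (nat \<lfloor>sqrt (real n)\<rfloor>) = real_of_int \<lfloor>sqrt (real n)\<rfloor>" by simp
      then show "real (Suc (k n)) \<le> sqrt (real n)" "sqrt (real n) \<le> real (Suc (Suc (k n)))"
        unfolding eq of_nat_Suc using floor_correct[of "sqrt (real n)"] by linarith+
    qed
    have "(real (Suc (k n)))\<^sup>2 \<le> (sqrt (real n))\<^sup>2" "(sqrt (real n))\<^sup>2 \<le> (real (Suc (Suc (k n))))\<^sup>2"
      by (rule power_mono[OF *(1)], simp) (rule power_mono[OF *(2)], simp)
    then have "real ((Suc (k n))\<^sup>2) \<le> real n" "real n \<le> real ((Suc (Suc (k n)))\<^sup>2)"
      by simp_all
    then show "(Suc (k n))\<^sup>2 \<le> n" "n \<le> (Suc (Suc (k n)))\<^sup>2"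
      by (simp_all only: of_nat_le_iff)
  qed
  have k_lim: "filterlim k at_top sequentially"
  proof -
    have "filterlim (\<lambda>n. sqrt (real n)) at_top sequentially"
      by (intro filterlim_compose[OF sqrt_at_top] filterlim_real_sequentially)
    then have "filterlim (\<lambda>n. nat (floor (sqrt (real n)))) at_top sequentially"
      by (intro filterlim_compose[OF filterlim_nat_sequentially]
                filterlim_compose[OF filterlim_floor_sequentially])
    then show ?thesis unfolding k_def by (rule filterlim_minus_const_nat_at_top[THEN filterlim_compose, rotated])
  qed
  define a where "a k = S ((Suc k)\<^sup>2) / real ((Suc k)\<^sup>2)" for k
  define r where "r k = (real (Suc k) / real (Suc (Suc k)))\<^sup>2" for k
  have a: "a \<longlonglongrightarrow> m" using lim by (simp add: a_def[abs_def])
  have r: "r \<longlonglongrightarrow> 1"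
    unfolding r_def using tendsto_power[OF LIMSEQ_Suc[OF LIMSEQ_n_over_Suc_n], of 2] by simp
  have "(\<lambda>k. a k * r k) \<longlonglongrightarrow> m * 1" by (intro tendsto_mult a r)
  from filterlim_compose[OF this k_lim]
  have lower: "(\<lambda>n. a (k n) * r (k n)) \<longlonglongrightarrow> m" by simp
  have "(\<lambda>k. a (Suc k) / r k) \<longlonglongrightarrow> m / 1"
    by (intro tendsto_divide r LIMSEQ_Suc[OF a]) simp
  from filterlim_compose[OF this k_lim]
  have upper: "(\<lambda>n. a (Suc (k n)) / r (k n)) \<longlonglongrightarrow> m" by simp
  have Spos: "0 \<le> S n" for n
    using monoD[OF mono, of 0 n] S0 by simp
  show ?thesis
  proof (rule tendsto_sandwich[OF _ _ lower upper])
    show "\<forall>\<^sub>F n in sequentially. a (k n) * r (k n) \<le> S n / real n"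
      using eventually_ge_at_top[of 1]
    proof eventually_elim
      case (elim n)
      have "a (k n) * r (k n) = S ((Suc (k n))\<^sup>2) / real ((Suc (Suc (k n)))\<^sup>2)"
        by (simp add: a_def r_def power_divide del: of_nat_Suc)
      also have "\<dots> \<le> S n / real n"
        using k[OF elim] elim Spos by (intro frac_le monoD[OF mono]) (auto simp del: of_nat_power power_Suc)
      finally show ?case .
    qed
    show "\<forall>\<^sub>F n in sequentially. S n / real n \<le> a (Suc (k n)) / r (k n)"
      using eventually_ge_at_top[of 1]
    proof eventually_elim
      case (elim n)
      have "S n / real n \<le> S ((Suc (Suc (k n)))\<^sup>2) / real ((Suc (k n))\<^sup>2)"
        using k[OF elim] elim Spos by (intro frac_le monoD[OF mono]) (auto simp del: of_nat_power power_Suc)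
      also have "\<dots> = a (Suc (k n)) / r (k n)"
        by (simp add: a_def r_def power_divide del: of_nat_Suc)
      finally show ?case .
    qed
  qed
qed

lemma (in prob_space) expectation_square_sum_uncorrelated:
  fixes Y :: "nat \<Rightarrow> 'a \<Rightarrow> real"
  assumes int: "\<And>i j. integrable M (\<lambda>x. Y i x * Y j x)"
    and sq: "\<And>i. expectation (\<lambda>x. (Y i x)\<^sup>2) = s"
    and un: "\<And>i j. i \<noteq> j \<Longrightarrow> expectation (\<lambda>x. Y i x * Y j x) = 0"
  shows "integrable M (\<lambda>x. (\<Sum>i<n. Y i x)\<^sup>2)"
    and "expectation (\<lambda>x. (\<Sum>i<n. Y i x)\<^sup>2) = real n * s"
proof -
  have *: "(\<Sum>i<n. Y i x)\<^sup>2 = (\<Sum>i<n. \<Sum>j<n. Y i x * Y j x)" for x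
    by (simp add: power2_eq_square sum_product)
  show "integrable M (\<lambda>x. (\<Sum>i<n. Y i x)\<^sup>2)"
    unfolding * by (intro Bochner_Integration.integrable_sum int)
  have "expectation (\<lambda>x. (\<Sum>i<n. Y i x)\<^sup>2) = (\<Sum>i<n. \<Sum>j<n. expectation (\<lambda>x. Y i x * Y j x))"
    unfolding * by (subst Bochner_Integration.integral_sum; (intro Bochner_Integration.integrable_sum int)?)
      (intro sum.cong refl Bochner_Integration.integral_sum int)
  also have "\<dots> = (\<Sum>i<n. \<Sum>j<n. if j = i then s else 0)"
    using sq un by (intro sum.cong) (auto simp: power2_eq_square)
  also have "\<dots> = real n * s" by simp
  finally show "expectation (\<lambda>x. (\<Sum>i<n. Y i x)\<^sup>2) = real n * s" .
qed

text \<open>Along the squares the variances of the averages are \<open>s / (Suc k)^2\<close>, hence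
  summable, so the squared deviations have an almost surely finite sum and tend to 0. Nonnegativity
  makes the partial sums monotone, which fills in the times between squares.\<close>

theorem (in prob_space) strong_law_nonneg_L2:
  fixes X :: "nat \<Rightarrow> 'a \<Rightarrow> real"
  assumes nonneg: "\<And>i x. 0 \<le> X i x"
    and int: "\<And>i j. integrable M (\<lambda>x. (X i x - m) * (X j x - m))"
    and sq: "\<And>i. expectation (\<lambda>x. (X i x - m)\<^sup>2) = s"
    and un: "\<And>i j. i \<noteq> j \<Longrightarrow> expectation (\<lambda>x. (X i x - m) * (X j x - m)) = 0"
  shows "AE x in M. (\<lambda>n. (\<Sum>i<n. X i x) / real n) \<longlonglongrightarrow> m"
proof -
  define Z where "Z k x = ((\<Sum>i<(Suc k)\<^sup>2. X i x - m) / real ((Suc k)\<^sup>2))\<^sup>2" for k x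
  note sums = expectation_square_sum_uncorrelated[of "\<lambda>i x. X i x - m", OF int sq un]
  have Zint: "integrable M (Z k)" for k
    unfolding Z_def[abs_def] power_divide by (intro integrable_divide sums(1))
  have Zexp: "expectation (Z k) = s / (real (Suc k))\<^sup>2" for k
  proof -
    have "expectation (\<lambda>x. (\<Sum>i<(Suc k)\<^sup>2. X i x - m)\<^sup>2) = real ((Suc k)\<^sup>2) * s"
      by (rule sums(2))
    moreover have "expectation (Z k) =
        expectation (\<lambda>x. (\<Sum>i<(Suc k)\<^sup>2. X i x - m)\<^sup>2) / (real ((Suc k)\<^sup>2))\<^sup>2"
      unfolding Z_def[abs_def] power_divide by (rule integral_divide_zero)
    ultimately show ?thesis
      by (simp only: of_nat_power) (simp add: power2_eq_square del: of_nat_Suc)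
  qed
  have Z0: "0 \<le> Z k x" for k x by (simp add: Z_def)
  have [measurable]: "Z k \<in> borel_measurable M" for k using Zint by auto
  have "(\<integral>\<^sup>+x. (\<Sum>k. ennreal (Z k x)) \<partial>M) = (\<Sum>k. \<integral>\<^sup>+x. ennreal (Z k x) \<partial>M)"
    by (rule nn_integral_suminf) measurable
  also have "\<dots> = (\<Sum>k. ennreal (s / (real (Suc k))\<^sup>2))"
    by (simp add: nn_integral_eq_integral[OF Zint] Z0 Zexp del: of_nat_Suc)
  also have "\<dots> < \<infinity>"
  proof -
    have "summable (\<lambda>k. 1 / (real (Suc k))\<^sup>2)"
      using inverse_power_summable[of 2, where 'a=real] summable_Suc_iff[of "\<lambda>k. inverse ((real k)\<^sup>2)"]
      by (simp add: inverse_eq_divide del: of_nat_Suc)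
    from summable_mult[OF this, of s] have "summable (\<lambda>k. s / (real (Suc k))\<^sup>2)" by simp
    moreover have "0 \<le> s" using sq[of 0] by (metis integral_nonneg_AE zero_le_power2 AE_I2)
    ultimately show ?thesis by (simp add: suminf_ennreal_eq[OF _ summable_sums] del: of_nat_Suc)
  qed
  finally have "AE x in M. (\<Sum>k. ennreal (Z k x)) \<noteq> \<infinity>"
    by (intro nn_integral_PInf_AE) auto
  then show ?thesis
  proof eventually_elim
    case (elim x)
    have "summable (\<lambda>k. Z k x)"
      using elim Z0 by (intro summable_suminf_not_top) auto
    then have "(\<lambda>k. sqrt (Z k x)) \<longlonglongrightarrow> sqrt 0"
      by (intro tendsto_real_sqrt summable_LIMSEQ_zero)
    then have "(\<lambda>k. (\<Sum>i<(Suc k)\<^sup>2. X i x - m) / real ((Suc k)\<^sup>2)) \<longlonglongrightarrow> 0"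
      by (simp add: Z_def tendsto_rabs_zero_iff del: of_nat_power power_Suc of_nat_Suc abs_divide)
    then have "(\<lambda>k. (\<Sum>i<(Suc k)\<^sup>2. X i x - m) / real ((Suc k)\<^sup>2) + m) \<longlonglongrightarrow> 0 + m"
      by (intro tendsto_intros)
    moreover have "(\<Sum>i<(Suc k)\<^sup>2. X i x - m) / real ((Suc k)\<^sup>2) + m =
        (\<Sum>i<(Suc k)\<^sup>2. X i x) / real ((Suc k)\<^sup>2)" for k
      by (simp add: sum_subtractf field_simps del: power_Suc of_nat_Suc)
    ultimately have "(\<lambda>k. (\<Sum>i<(Suc k)\<^sup>2. X i x) / real ((Suc k)\<^sup>2)) \<longlonglongrightarrow> m"
      by simp
    then show ?case
      by (intro average_tendsto_of_square_subsequence)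
         (auto intro!: incseq_SucI simp: nonneg)
  qed
qed

section \<open>Walks encoded by their excursions\<close>

fun move :: "bool option \<Rightarrow> int \<times> int" where
  "move None = e2"
| "move (Some b) = (if b then e1 else - e1)"

lemma move_eq_iff [simp]: "move m = move m' \<longleftrightarrow> m = m'"
  by (cases m; cases m') (auto simp: e1_def e2_def)

definition drift :: "bool list \<Rightarrow> int" where
  "drift l = (\<Sum>b\<leftarrow>l. if b then 1 else - 1)"

lemma drift_simps [simp]:
  "drift [] = 0" "drift (b # l) = (if b then 1 else - 1) + drift l"
  by (simp_all add: drift_def)

lemma abs_drift_le: "\<bar>drift l\<bar> \<le> int (length l)"
  by (induction l) auto

lemma drift_flip [simp]: "drift (map Not l) = - drift l"
  by (induction l) auto

text \<open>The walk is encoded by the sequence \<open>w\<close> of its excursions: \<open>w k\<close> lists the horizontal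
  steps (\<open>True\<close> to the right) made in row \<open>k\<close> before the step \<open>e\<^sub>2\<close> to the next row.\<close>

definition first_move :: "(nat \<Rightarrow> bool list) \<Rightarrow> bool option" where
  "first_move w = (case w 0 of [] \<Rightarrow> None | b # l \<Rightarrow> Some b)"

text \<open>What is left after one step is again a sequence of excursions, so \<open>walk\<close>
  can recurse on the number of steps alone.\<close>

definition advance :: "(nat \<Rightarrow> bool list) \<Rightarrow> nat \<Rightarrow> bool list" where
  "advance w = (case w 0 of [] \<Rightarrow> (\<lambda>i. w (Suc i)) | b # l \<Rightarrow> w(0 := l))"

primrec walk :: "nat \<Rightarrow> (nat \<Rightarrow> bool list) \<Rightarrow> int \<times> int" where
  "walk 0 w = 0"
| "walk (Suc n) w = move (first_move w) + walk n (advance w)"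

primrec emits :: "bool option list \<Rightarrow> (nat \<Rightarrow> bool list) \<Rightarrow> bool" where
  "emits [] w \<longleftrightarrow> True"
| "emits (m # ms) w \<longleftrightarrow> first_move w = m \<and> emits ms (advance w)"

definition site :: "bool option list \<Rightarrow> nat \<Rightarrow> int \<times> int" where
  "site ms i = sum_list (map move (take i ms))"

lemma site_simps [simp]:
  "site ms 0 = 0" "site (m # ms) (Suc i) = move m + site ms i"
  by (simp_all add: site_def)

text \<open>Since \<open>move\<close> is injective, positions and moves carry the same information.
  Cylinders of path space thus become events about the excursions.\<close>

lemma walk_eq_site_iff_emits:
  "(\<forall>i\<le>length ms. walk i w = site ms i) \<longleftrightarrow> emits ms w"
proof (induction ms arbitrary: w)
  case (Cons m ms)
  have "(\<forall>i\<le>length (m # ms). walk i w = site (m # ms) i) \<longleftrightarrow>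
      (\<forall>i\<le>length ms. move (first_move w) + walk i (advance w) = move m + site ms i)"
    by (simp add: All_less_Suc2 less_Suc_eq_le[symmetric] del: All_less_Suc)
  also have "\<dots> \<longleftrightarrow> first_move w = m \<and> (\<forall>i\<le>length ms. walk i (advance w) = site ms i)"
  proof safe
    assume "\<forall>i\<le>length ms. move (first_move w) + walk i (advance w) = move m + site ms i"
    from this[rule_format, of 0] show *: "first_move w = m" by simp
    fix i assume "i \<le> length ms"
    then show "walk i (advance w) = site ms i"
      using \<open>\<forall>i\<le>length ms. _ i\<close> * by simp
  qed simp
  finally show ?case by (simp add: Cons.IH)
qed simp

text \<open>The first \<open>None\<close> closes the row, so the word before it determines
  \<open>w 0\<close> completely and the rest concerns only the shifted sequence.
  \<open>weight_excursion\<close> is the matching factorisation of weights.\<close>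

lemma emits_excursion_iff:
  "emits (map Some l @ None # ms) w \<longleftrightarrow> w 0 = l \<and> emits ms (\<lambda>i. w (Suc i))"
proof (induction l arbitrary: w)
  case Nil
  show ?case by (cases "w 0") (auto simp: first_move_def advance_def)
next
  case (Cons b l)
  show ?case by (cases "w 0") (auto simp: first_move_def advance_def Cons.IH)
qed

text \<open>Without \<open>None\<close> the row is still unfinished, and only a prefix of
  \<open>w 0\<close> is known.\<close>

lemma emits_horizontal_iff: "emits (map Some l) w \<longleftrightarrow> (\<exists>m. w 0 = l @ m)"
proof (induction l arbitrary: w)
  case (Cons b l)
  show ?case by (cases "w 0") (auto simp: first_move_def advance_def Cons.IH)
qed simp

lemma measurable_first_move [measurable]: "first_move \<in> path_space \<rightarrow>\<^sub>M count_space UNIV"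
  unfolding first_move_def by measurable

lemma measurable_advance [measurable]: "advance \<in> path_space \<rightarrow>\<^sub>M path_space"
proof -
  have "(\<lambda>w i. case w 0 of [] \<Rightarrow> w (Suc i) | b # l \<Rightarrow> if i = 0 then l else w i)
      \<in> path_space \<rightarrow>\<^sub>M (path_space :: (nat \<Rightarrow> bool list) measure)"
  proof (rule measurable_PiM_single')
    fix i
    show "(\<lambda>w. case w 0 of [] \<Rightarrow> w (Suc i) | b # l \<Rightarrow> if i = 0 then l else w i)
        \<in> path_space \<rightarrow>\<^sub>M count_space (UNIV :: bool list set)"
    proof (rule measurable_compose_countable[where g="\<lambda>w. w 0"
          and f="\<lambda>l w. case l of [] \<Rightarrow> w (Suc i) | b # l \<Rightarrow> if i = 0 then l else w i"])
      fix l :: "bool list"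
      show "(\<lambda>w. case l of [] \<Rightarrow> w (Suc i) | b # l \<Rightarrow> if i = 0 then l else w i)
          \<in> path_space \<rightarrow>\<^sub>M count_space UNIV"
        by (cases l; cases "i = 0") simp_all
    qed simp
  qed (simp add: space_PiM)
  also have "(\<lambda>w i. case w 0 of [] \<Rightarrow> w (Suc i) | b # l \<Rightarrow> if i = 0 then l else w i) = advance"
    by (auto simp: fun_eq_iff advance_def split: list.split)
  finally show ?thesis .
qed

lemma measurable_walk [measurable]: "walk n \<in> path_space \<rightarrow>\<^sub>M count_space UNIV"
proof (induction n)
  case (Suc n)
  note [measurable] = measurable_compose[OF measurable_advance Suc]
  show ?case by simp
qed simp

lemma measurable_walk_path: "(\<lambda>w n. walk n w) \<in> path_space \<rightarrow>\<^sub>M path_space"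
  by (rule measurable_PiM_single') (auto simp: space_PiM)

lemma walk_within_excursion:
  "j \<le> length (w 0) \<Longrightarrow> walk j w = (drift (take j (w 0)), 0)"
proof (induction j arbitrary: w)
  case (Suc j)
  then obtain b l where w0: "w 0 = b # l" by (cases "w 0") auto
  with Suc show ?case
    by (simp add: first_move_def advance_def e1_def)
qed (simp add: zero_prod_def)

lemma walk_after_excursion:
  "walk (Suc (length (w 0)) + n) w = (drift (w 0), 1) + walk n (\<lambda>i. w (Suc i))"
proof (induction "w 0" arbitrary: w)
  case Nil
  then have "w 0 = []" by simp
  then show ?case by (simp add: first_move_def advance_def e2_def)
next
  case (Cons b l)
  from Cons(2)[symmetric] have w0: "w 0 = b # l" .
  then have adv: "advance w = w(0 := l)" by (simp add: advance_def)
  have "walk (Suc (length (w 0)) + n) w = move (Some b) + walk (Suc (length l) + n) (w(0 := l))"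
    by (simp add: w0 first_move_def adv)
  also have "\<dots> = move (Some b) + ((drift l, 1) + walk n (\<lambda>i. w (Suc i)))"
    using Cons(1)[of "w(0 := l)"] by simp
  finally show ?case by (auto simp: w0 e1_def prod_eq_iff)
qed

lemma walk_decomposition:
  assumes "j \<le> length (w k)"
  shows "walk ((\<Sum>i<k. Suc (length (w i))) + j) w =
    ((\<Sum>i<k. drift (w i)) + drift (take j (w k)), int k)"
  using assms
proof (induction k arbitrary: w)
  case 0
  then show ?case using walk_within_excursion[of j w] by simp
next
  case (Suc k)
  let ?w = "\<lambda>i. w (Suc i)"
  have "(\<Sum>i<Suc k. Suc (length (w i))) + j = Suc (length (w 0)) + ((\<Sum>i<k. Suc (length (?w i))) + j)"
    by (subst sum.lessThan_Suc_shift) simp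
  then show ?case
    using Suc.IH[of ?w] Suc.prems
    by (simp only: walk_after_excursion, subst sum.lessThan_Suc_shift) simp
qed

lemma between_partial_sums:
  fixes t :: "nat \<Rightarrow> nat"
  assumes "\<And>i. 0 < t i"
  obtains k where "(\<Sum>i<k. t i) \<le> n" "n < (\<Sum>i<Suc k. t i)"
proof -
  have grow: "k \<le> (\<Sum>i<k. t i)" for k
  proof (induction k)
    case (Suc k)
    with assms[of k] show ?case by simp
  qed simp
  define k where "k = (LEAST k. n < (\<Sum>i<Suc k. t i))"
  have ex: "n < (\<Sum>i<Suc n. t i)" using grow[of "Suc n"] by linarith
  have 1: "n < (\<Sum>i<Suc k. t i)" unfolding k_def by (rule LeastI[of _ n]) (rule ex)
  have "(\<Sum>i<k. t i) \<le> n"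
  proof (cases k)
    case (Suc k')
    then have "\<not> n < (\<Sum>i<Suc k'. t i)"
      using not_less_Least[of k' "\<lambda>k. n < (\<Sum>i<Suc k. t i)"] unfolding k_def[symmetric] by simp
    with Suc show ?thesis by simp
  qed simp
  with 1 that show ?thesis by blast
qed

text \<open>Renewal argument: \<open>K n\<close>, the number of rows completed by time
  \<open>n\<close>, is also the height, and \<open>n\<close> lies between the total durations of
  \<open>K n\<close> and \<open>K n + 1\<close> excursions. This inverts the averages over rows into
  averages over time.\<close>

theorem walk_asymptotics:
  assumes T: "(\<lambda>k. (\<Sum>i<k. real (Suc (length (w i)))) / real k) \<longlonglongrightarrow> \<mu>"
    and D: "(\<lambda>k. (\<Sum>i<k. real_of_int (drift (w i))) / real k) \<longlonglongrightarrow> 0"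
    and \<mu>: "0 < \<mu>"
  shows "(\<lambda>n. inverse (real n) *\<^sub>R plane (walk n w)) \<longlonglongrightarrow> (0, inverse \<mu>)"
proof -
  let ?t = "\<lambda>i. Suc (length (w i))"
  have "\<exists>k. (\<Sum>i<k. ?t i) \<le> n \<and> n < (\<Sum>i<Suc k. ?t i)" for n
    by (rule between_partial_sums[of ?t n]) auto
  then obtain K where K: "\<And>n. (\<Sum>i<K n. ?t i) \<le> n" "\<And>n. n < (\<Sum>i<Suc (K n). ?t i)"
    by metis
  have K_lim: "filterlim K at_top sequentially"
    unfolding filterlim_at_top
  proof
    fix k
    show "\<forall>\<^sub>F n in sequentially. k \<le> K n"
      using eventually_ge_at_top[of "\<Sum>i<k. ?t i"]
    proof eventually_elim
      case (elim n)
      show "k \<le> K n"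
      proof (rule ccontr)
        assume "\<not> k \<le> K n"
        then have "(\<Sum>i<Suc (K n). ?t i) \<le> (\<Sum>i<k. ?t i)"
          by (intro sum_mono2) auto
        with elim K(2)[of n] show False by linarith
      qed
    qed
  qed
  define R where "R k = (\<Sum>i<k. real (?t i)) / real k" for k
  have R: "R \<longlonglongrightarrow> \<mu>" using T by (simp add: R_def[abs_def])
  \<comment> \<open>The total duration of \<open>Suc k\<close> excursions, renormalised by
    \<open>k\<close> so that it bounds \<open>n / K n\<close> from above.\<close>
  define U where "U k = R (Suc k) * (real (Suc k) / real k)" for k
  have U: "U \<longlonglongrightarrow> \<mu>"
  proof -
    have "(\<lambda>k. real (Suc k) / real k) \<longlonglongrightarrow> 1"
      by (rule LIMSEQ_Suc_n_over_n)
    from tendsto_mult[OF LIMSEQ_Suc[OF R] this] show ?thesis by (simp add: U_def[abs_def])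
  qed
  have U_eq: "U k = (\<Sum>i<Suc k. real (?t i)) / real k" for k
    by (simp add: U_def R_def del: sum.lessThan_Suc of_nat_Suc)
  have sandwich: "(\<Sum>i<K n. real (?t i)) \<le> real n" "real n \<le> (\<Sum>i<Suc (K n). real (?t i))" for n
    using K[of n] unfolding of_nat_sum[symmetric] of_nat_le_iff by linarith+
  have ratio: "(\<lambda>n. real n / real (K n)) \<longlonglongrightarrow> \<mu>"
  proof (rule tendsto_sandwich[OF _ _ filterlim_compose[OF R K_lim] filterlim_compose[OF U K_lim]])
    show "\<forall>\<^sub>F n in sequentially. R (K n) \<le> real n / real (K n)"
      unfolding R_def by (intro always_eventually allI divide_right_mono sandwich) simp
    show "\<forall>\<^sub>F n in sequentially. real n / real (K n) \<le> U (K n)"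
      unfolding U_eq by (intro always_eventually allI divide_right_mono sandwich) simp
  qed
  have snd_walk: "walk n w = ((\<Sum>i<K n. drift (w i)) + drift (take (n - (\<Sum>i<K n. ?t i)) (w (K n))), int (K n))" for n
    using walk_decomposition[of "n - (\<Sum>i<K n. ?t i)" w "K n"] K[of n] by simp
  have vertical: "(\<lambda>n. inverse (real n) * real (K n)) \<longlonglongrightarrow> inverse \<mu>"
    using tendsto_inverse[OF ratio] \<mu> by (simp add: field_simps)
  \<comment> \<open>The second summand is the duration of excursion \<open>k\<close> divided by
    \<open>k\<close>. It bounds the displacement in the unfinished row and vanishes because
    \<open>U\<close> and \<open>R\<close> have the same limit.\<close>
  define E where "E k = \<bar>(\<Sum>i<k. real_of_int (drift (w i))) / real k\<bar> + (U k - R k)" for k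
  have E: "E \<longlonglongrightarrow> 0"
  proof -
    have "E \<longlonglongrightarrow> \<bar>0\<bar> + (\<mu> - \<mu>)"
      unfolding E_def[abs_def] by (intro tendsto_intros D U R)
    then show ?thesis by simp
  qed
  have horizontal: "(\<lambda>n. inverse (real n) * real_of_int (fst (walk n w))) \<longlonglongrightarrow> 0"
  proof (rule Lim_null_comparison[OF _ filterlim_compose[OF E K_lim]])
    show "\<forall>\<^sub>F n in sequentially. norm (inverse (real n) * real_of_int (fst (walk n w))) \<le> E (K n)"
      using eventually_compose_filterlim[OF eventually_gt_at_top[of 0] K_lim]
    proof eventually_elim
      case (elim n)
      have Kn: "K n \<le> n"
      proof -
        have "(\<Sum>i<K n. 1) \<le> (\<Sum>i<K n. ?t i)" by (intro sum_mono) auto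
        with K(1)[of n] show ?thesis by simp
      qed
      let ?l = "take (n - (\<Sum>i<K n. ?t i)) (w (K n))"
      have l: "real_of_int \<bar>drift ?l\<bar> \<le> real (?t (K n))"
        using abs_drift_le[of ?l] by simp
      have "norm (inverse (real n) * real_of_int (fst (walk n w))) = \<bar>real_of_int (fst (walk n w))\<bar> / real n"
        by (simp add: abs_mult field_simps)
      also have "\<dots> \<le> \<bar>real_of_int (fst (walk n w))\<bar> / real (K n)"
        using elim Kn by (intro divide_left_mono) auto
      also have "\<dots> \<le> (\<bar>\<Sum>i<K n. real_of_int (drift (w i))\<bar> + real (?t (K n))) / real (K n)"
        unfolding snd_walk fst_conv of_int_add of_int_sum using l by (intro divide_right_mono) auto
      also have "\<dots> = E (K n)"
        using elim by (simp add: E_def U_eq R_def field_simps abs_divide)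
      finally show ?case .
    qed
  qed
  have "(\<lambda>n. (inverse (real n) * real_of_int (fst (walk n w)), inverse (real n) * real (K n)))
      \<longlonglongrightarrow> (0, inverse \<mu>)"
    by (intro tendsto_Pair horizontal vertical)
  then show ?thesis
    by (simp add: plane_def snd_walk)
qed

section \<open>Annealed path weights\<close>

abbreviation lists_of_length :: "nat \<Rightarrow> bool list set" where
  "lists_of_length n \<equiv> {l. length l = n}"

lemma finite_lists_of_length [simp]: "finite (lists_of_length n)"
  using finite_lists_length_eq[of "UNIV :: bool set" n] by simp

lemma sum_lists_Suc_Cons:
  "sum f (lists_of_length (Suc n)) = (\<Sum>l\<in>lists_of_length n. f (True # l) + f (False # l))"
proof -
  have *: "lists_of_length (Suc n) = (#) True ` lists_of_length n \<union> (#) False ` lists_of_length n"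
    by (auto simp: length_Suc_conv)
  show ?thesis
    unfolding * by (subst sum.union_disjoint) (auto simp: sum.reindex sum.distrib)
qed

lemma sum_lists_Suc_snoc:
  "sum f (lists_of_length (Suc n)) = (\<Sum>l\<in>lists_of_length n. f (l @ [True]) + f (l @ [False]))"
proof -
  have *: "lists_of_length (Suc n) = (\<lambda>l. l @ [True]) ` lists_of_length n \<union> (\<lambda>l. l @ [False]) ` lists_of_length n"
    by (auto simp: length_Suc_conv_rev)
  show ?thesis
    unfolding * by (subst sum.union_disjoint) (auto simp: sum.reindex inj_on_def sum.distrib)
qed

text \<open>The single term with \<open>Suc i = a\<close> suffices. With indicators of runs as
  \<open>c\<close>, a power of a random distance is bounded by a series whose mean is
  explicit.\<close>

lemma fourth_power_le_suminf:
  fixes c :: "nat \<Rightarrow> ennreal"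
  assumes "\<And>i. i < a \<Longrightarrow> c i = 1"
  shows "ennreal (real a ^ 4) \<le> (\<Sum>i. ennreal (real (Suc i) ^ 4) * c i)"
proof (cases a)
  case (Suc i)
  then have "ennreal (real a ^ 4) = (\<Sum>j\<in>{i}. ennreal (real (Suc j) ^ 4) * c j)"
    using assms[of i] by simp
  also have "\<dots> \<le> (\<Sum>i. ennreal (real (Suc i) ^ 4) * c i)"
    by (rule sum_le_suminf) auto
  finally show ?thesis .
qed simp

text \<open>Sets rather than lists: a site constrains the environment once, however often it is
  visited. In contrast, \<open>horizontal_count\<close> below counts every visit, since each
  horizontal step costs a factor 1/2.\<close>

fun horizontal_sites vertical_sites :: "int \<times> int \<Rightarrow> bool option list \<Rightarrow> (int \<times> int) set" where
  "horizontal_sites x [] = {}"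
| "horizontal_sites x (m # ms) = (if m = None then {} else {x}) \<union> horizontal_sites (x + move m) ms"
| "vertical_sites x [] = {}"
| "vertical_sites x (m # ms) = (if m = None then {x} else {}) \<union> vertical_sites (x + move m) ms"

definition horizontal_count :: "bool option list \<Rightarrow> nat" where
  "horizontal_count ms = length (filter (\<lambda>m. m \<noteq> None) ms)"

lemma finite_sites [simp]: "finite (horizontal_sites x ms)" "finite (vertical_sites x ms)"
  by (induction ms arbitrary: x) auto

lemma sites_translate:
  "horizontal_sites (z + x) ms = (+) z ` horizontal_sites x ms"
  "vertical_sites (z + x) ms = (+) z ` vertical_sites x ms"
  by (induction ms arbitrary: x) (auto simp: add.assoc image_Un)

definition mirror :: "int \<times> int \<Rightarrow> int \<times> int" where
  "mirror x = (- fst x, snd x)"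

lemma mirror_add_move: "mirror (x + move m) = mirror x + move (map_option Not m)"
  by (cases m) (auto simp: mirror_def e1_def e2_def)

lemma sites_mirror:
  "horizontal_sites (mirror x) (map (map_option Not) ms) = mirror ` horizontal_sites x ms"
  "vertical_sites (mirror x) (map (map_option Not) ms) = mirror ` vertical_sites x ms"
  by (induction ms arbitrary: x) (auto simp: mirror_add_move[symmetric] image_Un)

lemma sites_append:
  "horizontal_sites x (ms @ ms') = horizontal_sites x ms \<union> horizontal_sites (x + sum_list (map move ms)) ms'"
  "vertical_sites x (ms @ ms') = vertical_sites x ms \<union> vertical_sites (x + sum_list (map move ms)) ms'"
  by (induction ms arbitrary: x) (auto simp: add.assoc)

lemma sites_above:
  "horizontal_sites x ms \<union> vertical_sites x ms \<subseteq> {y. snd x \<le> snd y}"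
proof (induction ms arbitrary: x)
  case (Cons m ms)
  have "snd x \<le> snd (x + move m)" by (cases m) (auto simp: e1_def e2_def)
  with Cons[of "x + move m"] show ?case by auto
qed simp

lemma sites_in_row:
  "horizontal_sites x (map Some l) \<subseteq> {y. snd y = snd x} \<and> vertical_sites x (map Some l) = {}"
proof (induction l arbitrary: x)
  case (Cons b l)
  have "snd (x + move (Some b)) = snd x" by (auto simp: e1_def)
  with Cons[of "x + move (Some b)"] show ?case by (auto simp del: move.simps)
qed simp

lemma sum_list_move_horizontal: "sum_list (map move (map Some l)) = (drift l, 0)"
  by (induction l) (auto simp: e1_def zero_prod_def)

text \<open>\<open>follow g x ms\<close> is the quenched probability that the walk started at \<open>x\<close> makes the moves \<open>ms\<close>.\<close>

primrec follow :: "(int \<times> int \<Rightarrow> (int \<times> int) set) \<Rightarrow> int \<times> int \<Rightarrow> bool option list \<Rightarrow> real" where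
  "follow g x [] = 1"
| "follow g x (m # ms) = pmf (uniform_step g x) (x + move m) * follow g (x + move m) ms"

lemma follow_bounds: "0 \<le> follow g x ms" "follow g x ms \<le> 1"
  by (induction ms arbitrary: x) (simp_all add: mult_le_one pmf_le_1)

lemma follow_append:
  "follow g x (ms @ ms') = follow g x ms * follow g (x + sum_list (map move ms)) ms'"
  by (induction ms arbitrary: x) (auto simp: add.assoc)

lemma follow_eq_prod:
  "follow g x ms = (\<Prod>i<length ms. pmf (uniform_step g (x + site ms i)) (x + site ms (Suc i)))"
proof (induction ms arbitrary: x)
  case (Cons m ms)
  show ?case
    by (simp add: Cons.IH prod.lessThan_Suc_shift add.assoc del: prod.lessThan_Suc)
qed simp

lemma quenched_law_cylinder:
  "emeasure (quenched_law g) {X. \<forall>i\<le>length ms. X i = site ms i} = ennreal (follow g 0 ms)"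
  unfolding quenched_law_def emeasure_chain_law_cylinder by (simp add: follow_eq_prod)

section \<open>Quenched probabilities when every site is horizontal or vertical\<close>

definition hv_config :: "(int \<times> int \<Rightarrow> (int \<times> int) set) \<Rightarrow> bool" where
  "hv_config g \<longleftrightarrow> (\<forall>x. g x = {e1, - e1} \<or> g x = {e2})"

lemma hv_configD: "hv_config g \<Longrightarrow> g x = {e1, - e1} \<or> g x = {e2}"
  by (simp only: hv_config_def)

lemma horizontal_neq_vertical: "{e1, - e1} \<noteq> {e2}"
  by (auto simp: e1_def e2_def doubleton_eq_iff)

lemma jump_sets_hv [simp]: "{e1, - e1} \<in> jump_sets" "{e2} \<in> jump_sets"
  by (auto simp: jump_sets_def)

lemma pmf_uniform_step_horizontal:
  assumes "g x = {e1, - e1}"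
  shows "pmf (uniform_step g x) (x + e) = (if e = e1 \<or> e = - e1 then 1 / 2 else 0)"
proof -
  have "card {e1, - e1} = 2" by (simp add: e1_def)
  with assms show ?thesis by (subst pmf_uniform_step) simp_all
qed

lemma pmf_uniform_step_vertical:
  assumes "g x = {e2}"
  shows "pmf (uniform_step g x) (x + e) = (if e = e2 then 1 else 0)"
  using assms by (subst pmf_uniform_step) simp_all

lemma e1_e2_distinct [simp]:
  "e1 \<noteq> e2" "e2 \<noteq> e1" "- e1 \<noteq> e2" "e2 \<noteq> - e1" "e1 \<noteq> - e1" "- e1 \<noteq> e1"
  by (simp_all add: e1_def e2_def)

lemma pmf_uniform_step_move:
  assumes "hv_config g"
  shows "pmf (uniform_step g x) (x + move m) =
    (if m = None then of_bool (g x = {e2}) else of_bool (g x = {e1, - e1}) / 2)"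
proof (cases "g x = {e1, - e1}")
  case True
  then have "g x \<noteq> {e2}" using horizontal_neq_vertical by simp
  with True pmf_uniform_step_horizontal[of g x "move m", OF True] show ?thesis
    by (cases m) simp_all
next
  case False
  with hv_configD[OF assms, of x] have v: "g x = {e2}" by blast
  with False pmf_uniform_step_vertical[of g x "move m", OF v] show ?thesis
    by (cases m) simp_all
qed

lemma pmf_uniform_step_non_move:
  assumes "hv_config g" "e \<notin> range move"
  shows "pmf (uniform_step g x) (x + e) = 0"
proof -
  have "e \<noteq> e1" "e \<noteq> - e1" "e \<noteq> e2"
    using assms(2) rangeI[of move None] rangeI[of move "Some True"] rangeI[of move "Some False"] by auto
  then show ?thesis
    using hv_configD[OF assms(1), of x] pmf_uniform_step_horizontal[of g x e]
      pmf_uniform_step_vertical[of g x e] by metis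
qed

text \<open>Each step has probability 0, 1/2 or 1, so the environment enters only through an
  indicator, whose mean is the probability of a pattern on finitely many sites.\<close>

lemma follow_hv_config:
  assumes "hv_config g"
  shows "follow g x ms = (1 / 2) ^ horizontal_count ms *
    of_bool ((\<forall>y\<in>horizontal_sites x ms. g y = {e1, - e1}) \<and> (\<forall>y\<in>vertical_sites x ms. g y = {e2}))"
  by (induction ms arbitrary: x) (auto simp: pmf_uniform_step_move[OF assms] horizontal_count_def)

lemma follow_extend:
  assumes "hv_config g"
  shows "follow g x ms =
    follow g x (ms @ [None]) + follow g x (ms @ [Some True]) + follow g x (ms @ [Some False])"
proof -
  let ?y = "x + sum_list (map move ms)"
  have "pmf (uniform_step g ?y) (?y + move None) + pmf (uniform_step g ?y) (?y + move (Some True))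
      + pmf (uniform_step g ?y) (?y + move (Some False)) = 1"
    using hv_configD[OF assms, of ?y] horizontal_neq_vertical
    unfolding pmf_uniform_step_move[OF assms] by (elim disjE) simp_all
  then show ?thesis
    unfolding follow_append by (simp add: distrib_left[symmetric] del: move.simps)
qed

text \<open>As long as it makes only horizontal steps, the walk is simple random walk killed at the
  vertical sites of the row. Both sides obey the same first-step recursion.\<close>

lemma sum_follow_horizontal:
  assumes "hv_config g"
  shows "(\<Sum>l\<in>lists_of_length n. follow g (i, 0) (map Some l)) = stay {k. g (k, 0) = {e1, - e1}} n i"
proof (induction n arbitrary: i)
  case (Suc n)
  let ?h = "of_bool (g (i, 0) = {e1, - e1}) / 2 :: real"
  let ?S = "\<lambda>i. \<Sum>l\<in>lists_of_length n. follow g (i, 0) (map Some l)"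
  have step: "follow g (i, 0) (map Some (b # l)) =
      ?h * follow g (i + (if b then 1 else - 1), 0) (map Some l)" for b l
  proof -
    have "(i, 0) + move (Some b) = (i + (if b then 1 else - 1), 0)"
      by (simp add: e1_def)
    then show ?thesis
      using pmf_uniform_step_move[OF assms, of "(i, 0)" "Some b"] by (simp del: move.simps)
  qed
  have "(\<Sum>l\<in>lists_of_length (Suc n). follow g (i, 0) (map Some l)) = ?h * (?S (i + 1) + ?S (i - 1))"
    unfolding sum_lists_Suc_Cons step by (simp add: sum.distrib sum_distrib_left distrib_left)
  then show ?case
    unfolding Suc.IH by (cases "g (i, 0) = {e1, - e1}") simp_all
qed simp

section \<open>Averaging over the environment\<close>

locale hv_environment =
  fixes p :: real and M :: "'w measure" and G :: "int \<times> int \<Rightarrow> 'w \<Rightarrow> (int \<times> int) set"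
  assumes p_pos: "0 < p" and p_less_1: "p < 1" and iid: "iid_environment M G"
    and prob_horizontal: "\<And>x. measure M {w \<in> space M. G x w = {e1, - e1}} = p"
    and prob_vertical: "\<And>x. measure M {w \<in> space M. G x w = {e2}} = 1 - p"
begin

sublocale prob_space M
  using iid by (simp add: iid_environment_def)

lemma measurable_G [measurable]: "G x \<in> M \<rightarrow>\<^sub>M count_space jump_sets"
  by (rule iid_environment_measurable[OF iid])

lemma sets_G_eq [measurable]: "S \<in> jump_sets \<Longrightarrow> {w \<in> space M. G x w = S} \<in> sets M"
  using measurable_sets[OF measurable_G[of x], of "{S}"]
  by (simp add: vimage_def Int_def conj_commute)

text \<open>The two given probabilities add up to 1, so any other jump set has probability 0 at each
  site, and there are only countably many sites.\<close>

lemma AE_hv_config: "AE w in M. hv_config (\<lambda>x. G x w)"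
proof -
  have "AE w in M. G x w = {e1, - e1} \<or> G x w = {e2}" for x
  proof (rule iffD1[OF prob_Collect_eq_1])
    have "{w \<in> space M. G x w = {e1, - e1} \<or> G x w = {e2}} =
        {w \<in> space M. G x w = {e1, - e1}} \<union> {w \<in> space M. G x w = {e2}}" by auto
    moreover have "prob ({w \<in> space M. G x w = {e1, - e1}} \<union> {w \<in> space M. G x w = {e2}}) =
        prob {w \<in> space M. G x w = {e1, - e1}} + prob {w \<in> space M. G x w = {e2}}"
      using horizontal_neq_vertical by (intro finite_measure_Union sets_G_eq) auto
    ultimately show "prob {w \<in> space M. G x w = {e1, - e1} \<or> G x w = {e2}} = 1"
      by (simp add: prob_horizontal prob_vertical)
    show "{w \<in> space M. G x w = {e1, - e1} \<or> G x w = {e2}} \<in> events"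
      by (intro sets.sets_Collect_disj sets_G_eq) simp_all
  qed
  then show ?thesis by (simp add: hv_config_def AE_all_countable)
qed

definition pattern_prob :: "(int \<times> int) set \<Rightarrow> (int \<times> int) set \<Rightarrow> real" where
  "pattern_prob A B = (if A \<inter> B = {} then p ^ card A * (1 - p) ^ card B else 0)"

definition pattern :: "(int \<times> int) set \<Rightarrow> (int \<times> int) set \<Rightarrow> 'w set" where
  "pattern A B = {w \<in> space M. (\<forall>x\<in>A. G x w = {e1, - e1}) \<and> (\<forall>x\<in>B. G x w = {e2})}"

lemma sets_pattern [measurable]:
  assumes "finite A" "finite B"
  shows "pattern A B \<in> sets M"
proof -
  have "{w \<in> space M. \<forall>x\<in>A. G x w = {e1, - e1}} \<in> sets M" "{w \<in> space M. \<forall>x\<in>B. G x w = {e2}} \<in> sets M"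
    using assms by (auto intro!: sets.sets_Collect_finite_All')
  then show ?thesis
    unfolding pattern_def by (intro sets.sets_Collect_conj)
qed

lemma prob_pattern:
  assumes "finite A" "finite B"
  shows "prob (pattern A B) = pattern_prob A B"
proof (cases "A \<inter> B = {}")
  case False
  then have "pattern A B = {}"
    using horizontal_neq_vertical unfolding pattern_def by blast
  with False show ?thesis by (simp add: pattern_prob_def)
next
  case disj: True
  show ?thesis
  \<comment> \<open>The product formula is applied to a nonempty index set, and membership in
    \<open>space M\<close> is read off from one of the intersected sets. The empty pattern is
    therefore separate.\<close>
  proof (cases "A \<union> B = {}")
    case True
    then have "pattern A B = space M" by (auto simp: pattern_def)
    with True prob_space show ?thesis by (simp add: pattern_prob_def)
  next
    case False
    define E where "E x = (if x \<in> A then {{e1, - e1}} else {{e2}})" for x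
    have G_E: "prob (G x -` E x \<inter> space M) = (if x \<in> A then p else 1 - p)" for x
      using prob_horizontal[of x] prob_vertical[of x]
      by (simp add: E_def vimage_def Int_def conj_commute)
    have "pattern A B = (\<Inter>x\<in>A \<union> B. G x -` E x \<inter> space M)"
    proof (rule set_eqI)
      fix w
      have not_A: "x \<notin> A" if "x \<in> B" for x using disj that by blast
      have A: "(\<forall>x\<in>A. G x w \<in> E x) \<longleftrightarrow> (\<forall>x\<in>A. G x w = {e1, - e1})"
        by (intro ball_cong refl) (simp add: E_def)
      have B: "(\<forall>x\<in>B. G x w \<in> E x) \<longleftrightarrow> (\<forall>x\<in>B. G x w = {e2})"
        by (intro ball_cong refl) (simp add: E_def not_A)
      have "w \<in> (\<Inter>x\<in>A \<union> B. G x -` E x \<inter> space M) \<longleftrightarrow>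
          w \<in> space M \<and> (\<forall>x\<in>A. G x w \<in> E x) \<and> (\<forall>x\<in>B. G x w \<in> E x)"
        using False by blast
      then show "w \<in> pattern A B \<longleftrightarrow> w \<in> (\<Inter>x\<in>A \<union> B. G x -` E x \<inter> space M)"
        by (simp only: A B pattern_def mem_Collect_eq)
    qed
    also have "prob \<dots> = (\<Prod>x\<in>A \<union> B. prob (G x -` E x \<inter> space M))"
      using iid assms False
      by (intro indep_varsD[where I=UNIV and M'="\<lambda>_. count_space jump_sets"])
         (auto simp: iid_environment_def E_def)
    also have "\<dots> = (\<Prod>x\<in>A. if x \<in> A then p else 1 - p) * (\<Prod>x\<in>B. if x \<in> A then p else 1 - p)"
      unfolding G_E using assms disj by (intro prod.union_disjoint)
    also have "(\<Prod>x\<in>B. if x \<in> A then p else 1 - p) = (\<Prod>x\<in>B. 1 - p)"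
      using disj by (intro prod.cong) auto
    finally show ?thesis using disj by (simp add: pattern_prob_def)
  qed
qed

lemma pattern_prob_image:
  assumes "inj f"
  shows "pattern_prob (f ` A) (f ` B) = pattern_prob A B"
proof -
  have "f ` A \<inter> f ` B = {} \<longleftrightarrow> A \<inter> B = {}" using assms by (auto simp: inj_eq)
  with inj_on_subset[OF assms] show ?thesis by (simp add: pattern_prob_def card_image)
qed

lemma pattern_prob_Un:
  assumes "finite A" "finite B" "finite A'" "finite B'" "(A \<union> B) \<inter> (A' \<union> B') = {}"
  shows "pattern_prob (A \<union> A') (B \<union> B') = pattern_prob A B * pattern_prob A' B'"
proof -
  have "(A \<union> A') \<inter> (B \<union> B') = {} \<longleftrightarrow> A \<inter> B = {} \<and> A' \<inter> B' = {}"
    using assms(5) by blast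
  moreover have "A \<inter> A' = {}" "B \<inter> B' = {}" using assms(5) by auto
  ultimately show ?thesis
    using assms by (simp add: pattern_prob_def card_Un_disjoint power_add)
qed

text \<open>The annealed probability that the walk from the origin begins with \<open>ms\<close>, in
  closed form; see \<open>expectation_follow\<close>.\<close>

definition weight :: "bool option list \<Rightarrow> real" where
  "weight ms = (1 / 2) ^ horizontal_count ms * pattern_prob (horizontal_sites 0 ms) (vertical_sites 0 ms)"

lemma measurable_follow [measurable]: "(\<lambda>w. follow (\<lambda>x. G x w) x ms) \<in> borel_measurable M"
proof (induction ms arbitrary: x)
  case (Cons m ms)
  have [measurable]: "(\<lambda>w. pmf (uniform_step (\<lambda>x. G x w) a) b) \<in> borel_measurable M" for a b
    unfolding uniform_step_def by (rule measurable_compose[OF measurable_G[of a]]) simp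
  note [measurable] = Cons
  show ?case by simp
qed simp

lemma integrable_follow: "integrable M (\<lambda>w. follow (\<lambda>x. G x w) x ms)"
  by (rule integrable_const_bound[of _ 1]) (auto simp: follow_bounds)

lemma expectation_follow: "expectation (\<lambda>w. follow (\<lambda>x. G x w) 0 ms) = weight ms"
proof -
  let ?P = "pattern (horizontal_sites 0 ms) (vertical_sites 0 ms)"
  have "expectation (\<lambda>w. follow (\<lambda>x. G x w) 0 ms) =
      expectation (\<lambda>w. (1 / 2) ^ horizontal_count ms * indicator ?P w)"
    using AE_hv_config
    by (intro integral_cong_AE) (auto simp: follow_hv_config pattern_def indicator_def)
  also have "\<dots> = weight ms"
    by (simp add: prob_pattern weight_def)
  finally show ?thesis .
qed

lemma weight_nonneg: "0 \<le> weight ms"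
  unfolding expectation_follow[symmetric] by (intro integral_nonneg_AE) (auto simp: follow_bounds)

lemma annealed_law_cylinder:
  "emeasure (annealed_law M G) {X. \<forall>i\<le>length ms. X i = site ms i} = ennreal (weight ms)"
  by (subst emeasure_annealed_law[OF iid sets_cylinder], unfold quenched_law_cylinder)
     (simp add: nn_integral_eq_integral[OF integrable_follow] follow_bounds expectation_follow)

text \<open>The moves up to \<open>None\<close> read only sites of row 0 and the later ones only
  rows from 1 on, so the two patterns are independent. Translation invariance then moves the
  entrance point \<open>?z\<close> of the next row back to the origin.\<close>

lemma weight_excursion:
  "weight (map Some l @ None # ms) = weight (map Some l @ [None]) * weight ms"
proof -
  let ?H = "\<lambda>ms. horizontal_sites 0 ms" and ?V = "\<lambda>ms. vertical_sites 0 ms"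
  let ?a = "map Some l @ [None]"
  let ?z = "(drift l, 1)"
  have sum_a: "sum_list (map move ?a) = ?z"
    unfolding map_append sum_list_append sum_list_move_horizontal by (simp add: e2_def)
  have split: "map Some l @ None # ms = ?a @ ms" by simp
  have H: "?H (?a @ ms) = ?H ?a \<union> (+) ?z ` ?H ms" and V: "?V (?a @ ms) = ?V ?a \<union> (+) ?z ` ?V ms"
    unfolding sites_append(1,2)[of _ ?a] sum_a by (simp_all add: sites_translate[symmetric])
  have low: "?H ?a \<union> ?V ?a \<subseteq> {y. snd y = 0}"
    using sites_in_row[of 0 l]
    unfolding sites_append sum_list_move_horizontal by auto
  have high: "(+) ?z ` ?H ms \<union> (+) ?z ` ?V ms \<subseteq> {y. 1 \<le> snd y}"
    using sites_above[of 0 ms] by auto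
  have "pattern_prob (?H (?a @ ms)) (?V (?a @ ms)) = pattern_prob (?H ?a) (?V ?a) * pattern_prob ((+) ?z ` ?H ms) ((+) ?z ` ?V ms)"
    unfolding H V
  proof (rule pattern_prob_Un)
    show "(?H ?a \<union> ?V ?a) \<inter> ((+) ?z ` ?H ms \<union> (+) ?z ` ?V ms) = {}"
    proof (rule ccontr)
      assume "\<not> ?thesis"
      then obtain y where "y \<in> ?H ?a \<union> ?V ?a" "y \<in> (+) ?z ` ?H ms \<union> (+) ?z ` ?V ms" by blast
      with low high have "snd y = 0" "1 \<le> snd y" by blast+
      then show False by simp
    qed
  qed auto
  also have "pattern_prob ((+) ?z ` ?H ms) ((+) ?z ` ?V ms) = pattern_prob (?H ms) (?V ms)"
    by (rule pattern_prob_image) simp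
  finally show ?thesis
    unfolding split by (simp add: weight_def horizontal_count_def power_add)
qed

lemma weight_mirror: "weight (map (map_option Not) ms) = weight ms"
proof -
  have "mirror 0 = 0" by (simp add: mirror_def zero_prod_def)
  moreover have "inj mirror" by (auto simp: inj_def mirror_def prod_eq_iff)
  moreover have "horizontal_count (map (map_option Not) ms) = horizontal_count ms"
    by (simp add: horizontal_count_def filter_map comp_def)
  ultimately show ?thesis
    using sites_mirror[of 0 ms] by (simp add: weight_def pattern_prob_image)
qed

definition excursion_weight :: "bool list \<Rightarrow> real" where
  "excursion_weight l = weight (map Some l @ [None])"

text \<open>The probability that the walk begins with the steps \<open>l\<close>. That it equals the
  total \<open>excursion_weight\<close> of all extensions of \<open>l\<close> is proved only in
  \<open>excursion_weight_sums\<close>, where it must be excluded that the row is never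
  left.\<close>

definition prefix_weight :: "bool list \<Rightarrow> real" where
  "prefix_weight l = weight (map Some l)"

lemma prefix_weight_split:
  "prefix_weight l = excursion_weight l + prefix_weight (l @ [True]) + prefix_weight (l @ [False])"
proof -
  let ?f = "\<lambda>ms w. follow (\<lambda>x. G x w) 0 ms"
  have "expectation (?f (map Some l)) =
      expectation (\<lambda>w. ?f (map Some l @ [None]) w + ?f (map Some l @ [Some True]) w + ?f (map Some l @ [Some False]) w)"
    using AE_hv_config by (intro integral_cong_AE) (auto intro: follow_extend)
  then show ?thesis
    by (simp add: integrable_follow expectation_follow excursion_weight_def prefix_weight_def)
qed

section \<open>The row of the origin and its nearest vertical sites\<close>

definition row :: "'w \<Rightarrow> int set" where
  "row w = {k. G (k, 0) w = {e1, - e1}}"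

definition tail :: "nat \<Rightarrow> real" where
  "tail n = sum prefix_weight (lists_of_length n)"

lemma nonneg [simp]: "0 \<le> excursion_weight l" "0 \<le> prefix_weight l" "0 \<le> tail n"
  by (simp_all add: excursion_weight_def prefix_weight_def tail_def weight_nonneg sum_nonneg)

lemma measurable_stay [measurable]: "(\<lambda>w. stay (row w) n i) \<in> borel_measurable M"
proof (induction n arbitrary: i)
  case (Suc n)
  note [measurable] = Suc
  have "(\<lambda>w. if G (i, 0) w = {e1, - e1} then (stay (row w) n (i + 1) + stay (row w) n (i - 1)) / 2 else 0)
      \<in> borel_measurable M"
    by (intro measurable_If sets_G_eq) auto
  moreover have "(\<lambda>w. stay (row w) (Suc n) i) =
      (\<lambda>w. if G (i, 0) w = {e1, - e1} then (stay (row w) n (i + 1) + stay (row w) n (i - 1)) / 2 else 0)"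
    by (auto simp: row_def)
  ultimately show ?case by simp
qed simp

text \<open>Links the two descriptions of long excursions: the sum of annealed path weights and the
  average of the quenched survival probability.\<close>

lemma nn_integral_stay: "(\<integral>\<^sup>+w. ennreal (stay (row w) n 0) \<partial>M) = ennreal (tail n)"
proof -
  have int: "integrable M (\<lambda>w. stay (row w) n 0)"
    by (rule integrable_const_bound[of _ 1]) (auto simp: stay_nonneg stay_le_1)
  have "expectation (\<lambda>w. stay (row w) n 0) =
      expectation (\<lambda>w. \<Sum>l\<in>lists_of_length n. follow (\<lambda>x. G x w) 0 (map Some l))"
  proof (intro integral_cong_AE)
    show "AE w in M. stay (row w) n 0 = (\<Sum>l\<in>lists_of_length n. follow (\<lambda>x. G x w) 0 (map Some l))"
      using AE_hv_config
    proof eventually_elim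
      case (elim w)
      show ?case
        unfolding row_def zero_prod_def by (rule sum_follow_horizontal[OF elim, symmetric])
    qed
  qed auto
  also have "\<dots> = tail n"
    by (simp add: integrable_follow expectation_follow tail_def prefix_weight_def)
  finally show ?thesis
    by (simp add: nn_integral_eq_integral[OF int] stay_nonneg)
qed

text \<open>Indicators of these events stand in for the distances to the nearest vertical sites, and
  their probabilities are plain powers of \<open>p\<close>.\<close>

definition run :: "nat \<Rightarrow> nat \<Rightarrow> 'w set" where
  "run i j = pattern ((\<lambda>k. (k, 0)) ` {- int i..int j}) {}"

lemma mem_run_iff: "w \<in> space M \<Longrightarrow> w \<in> run i j \<longleftrightarrow> {- int i..int j} \<subseteq> row w"
  by (simp add: run_def pattern_def row_def subset_eq)

lemma sets_run [measurable]: "run i j \<in> sets M"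
  by (simp add: run_def)

lemma prob_run: "prob (run i j) = p ^ Suc (i + j)"
  by (simp add: run_def prob_pattern pattern_prob_def card_image inj_on_def nat_add_distrib add.commute)

text \<open>On either side a horizontal run of \<open>n + 1\<close> sites has probability
  \<open>p ^ Suc n\<close>, which tends to 0, so an infinite run is a null event.\<close>

lemma AE_gap: "AE w in M. \<exists>a b :: nat. - int a \<notin> row w \<and> int b \<notin> row w"
proof -
  have lim: "(\<lambda>n. p ^ Suc n) \<longlonglongrightarrow> 0"
    using p_pos p_less_1 by (intro LIMSEQ_Suc LIMSEQ_power_zero) auto
  have null: "AE w in M. \<exists>n. w \<notin> A n" if A: "\<And>n. A n \<in> sets M" "\<And>n. prob (A n) = p ^ Suc n" for A
  proof -
    have "prob (\<Inter>n. A n) \<le> p ^ Suc n" for n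
      unfolding A(2)[symmetric] using A(1) by (intro finite_measure_mono) auto
    then have "prob (\<Inter>n. A n) \<le> 0"
      by (intro LIMSEQ_le_const[OF lim]) auto
    then have "emeasure M (\<Inter>n. A n) = 0"
      by (simp add: emeasure_eq_measure measure_le_0_iff)
    with A(1) have "AE w in M. w \<notin> (\<Inter>n. A n)"
      by (intro AE_not_in) (auto simp: null_sets_def)
    then show ?thesis by simp
  qed
  have "AE w in M. \<exists>n. w \<notin> run n 0" "AE w in M. \<exists>n. w \<notin> run 0 n"
    by (intro null; simp add: prob_run)+
  with AE_space show ?thesis
  proof eventually_elim
    case (elim w)
    then obtain n m where "w \<notin> run n 0" "w \<notin> run 0 m" by blast
    then obtain k k' where "k \<in> {- int n..0}" "k' \<in> {0..int m}" "k \<notin> row w" "k' \<notin> row w"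
      using mem_run_iff[OF elim(1)] by (metis of_nat_0 minus_zero subsetI)
    then show ?case by (intro exI[of _ "nat (- k)"] exI[of _ "nat k'"]) simp
  qed
qed

text \<open>The witnesses are the distances to the nearest vertical sites. Both are 0 exactly when
  the origin is vertical. The last clause records this, so that \<open>run i 0\<close> detects
  \<open>i < a\<close> and \<open>run 0 i\<close> detects \<open>i < b\<close>.\<close>

lemma AE_row_interval:
  "AE w in M. \<exists>a b :: nat. {- int a<..<int b} \<subseteq> row w \<and> - int a \<notin> row w \<and> int b \<notin> row w \<and>
     (\<forall>i j. w \<in> run i j \<longleftrightarrow> i < a \<and> j < b) \<and> (a = 0 \<longleftrightarrow> b = 0)"
  using AE_gap AE_space
proof eventually_elim
  case (elim w)
  from elim(1) obtain a0 b0 where ex: "- int a0 \<notin> row w" "int b0 \<notin> row w" by blast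
  define a where "a = (LEAST a. - int a \<notin> row w)"
  define b where "b = (LEAST b. int b \<notin> row w)"
  have a: "- int a \<notin> row w" "i < a \<Longrightarrow> - int i \<in> row w" for i
    using LeastI[of "\<lambda>a. - int a \<notin> row w", OF ex(1)] not_less_Least[of i "\<lambda>a. - int a \<notin> row w"]
    unfolding a_def by blast+
  have b: "int b \<notin> row w" "i < b \<Longrightarrow> int i \<in> row w" for i
    using LeastI[of "\<lambda>b. int b \<notin> row w", OF ex(2)] not_less_Least[of i "\<lambda>b. int b \<notin> row w"]
    unfolding b_def by blast+
  have inside: "k \<in> row w" if "- int a < k" "k < int b" for k
    using a(2)[of "nat (- k)"] b(2)[of "nat k"] that by (cases "0 \<le> k") auto
  have zero: "a = 0 \<longleftrightarrow> b = 0"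
    using a(1) a(2)[of 0] b(1) b(2)[of 0] by (cases "a = 0"; cases "b = 0") simp_all
  have "w \<in> run i j \<longleftrightarrow> i < a \<and> j < b" for i j
  proof -
    have "w \<in> run i j \<longleftrightarrow> {- int i..int j} \<subseteq> row w"
      by (rule mem_run_iff[OF elim(2)])
    also have "\<dots> \<longleftrightarrow> i < a \<and> j < b"
    proof
      assume sub: "{- int i..int j} \<subseteq> row w"
      have "\<not> a \<le> i" using subsetD[OF sub, of "- int a"] a(1) by auto
      moreover have "\<not> b \<le> j" using subsetD[OF sub, of "int b"] b(1) by auto
      ultimately show "i < a \<and> j < b" by simp
    qed (auto intro!: inside)
    finally show ?thesis .
  qed
  with a b inside zero show ?case by (intro exI[of _ a] exI[of _ b]) auto
qed

end

section \<open>Moments of the excursion law\<close>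

lemma summable_fourth_power_times_geometric:
  fixes p :: real
  assumes "0 < p" "p < 1"
  shows "summable (\<lambda>n. real (Suc n) ^ 4 * p ^ Suc n)"
proof -
  have "(\<lambda>n. (real (Suc (Suc n)) / real (Suc n)) ^ 4 * p) \<longlonglongrightarrow> 1 ^ 4 * p"
    by (intro tendsto_intros LIMSEQ_Suc[OF LIMSEQ_Suc_n_over_n])
  \<comment> \<open>Here \<open>(1 + p) / 2\<close> serves as a ratio strictly between the limit
    \<open>p\<close> and 1.\<close>
  then have "\<forall>\<^sub>F n in sequentially. (real (Suc (Suc n)) / real (Suc n)) ^ 4 * p < (1 + p) / 2"
    using assms by (intro order_tendstoD(2)) auto
  then obtain N where N: "\<And>n. n \<ge> N \<Longrightarrow> (real (Suc (Suc n)) / real (Suc n)) ^ 4 * p < (1 + p) / 2"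
    by (auto simp: eventually_at_top_linorder)
  show ?thesis
  proof (rule summable_ratio_test)
    show "(1 + p) / 2 < 1" using assms by simp
    fix n assume "N \<le> n"
    have "real (Suc (Suc n)) ^ 4 * p ^ Suc (Suc n) =
        ((real (Suc (Suc n)) / real (Suc n)) ^ 4 * p) * (real (Suc n) ^ 4 * p ^ Suc n)"
      by (simp add: power_divide del: of_nat_Suc)
    also have "\<dots> \<le> (1 + p) / 2 * (real (Suc n) ^ 4 * p ^ Suc n)"
      using N[OF \<open>N \<le> n\<close>] assms by (intro mult_right_mono) auto
    finally show "norm (real (Suc (Suc n)) ^ 4 * p ^ Suc (Suc n)) \<le> (1 + p) / 2 * norm (real (Suc n) ^ 4 * p ^ Suc n)"
      using assms by simp
  qed
qed

lemma square_sum3_le: "(x + y + z)\<^sup>2 \<le> 3 * (x\<^sup>2 + y\<^sup>2 + z\<^sup>2)" for x y z :: real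
  using zero_le_power2[of "x - y"] zero_le_power2[of "x - z"] zero_le_power2[of "y - z"]
  by (simp add: power2_eq_square algebra_simps)

lemma nn_integral_lists_of_length:
  fixes f :: "bool list \<Rightarrow> ennreal"
  shows "(\<integral>\<^sup>+l. f l \<partial>count_space UNIV) = (\<Sum>n. \<Sum>l\<in>lists_of_length n. f l)"
proof -
  have "f l = (\<Sum>n. f l * indicator (lists_of_length n) l)" for l
    by (subst suminf_finite[of "{length l}"]) (auto simp: indicator_def)
  then have "(\<integral>\<^sup>+l. f l \<partial>count_space UNIV) =
      (\<integral>\<^sup>+l. (\<Sum>n. f l * indicator (lists_of_length n) l) \<partial>count_space UNIV)"
    by (intro nn_integral_cong)
  also have "\<dots> = (\<Sum>n. \<integral>\<^sup>+l. f l * indicator (lists_of_length n) l \<partial>count_space UNIV)"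
    by (rule nn_integral_suminf) simp
  also have "\<dots> = (\<Sum>n. \<Sum>l\<in>lists_of_length n. f l)"
    by (simp add: nn_integral_count_space_indicator[symmetric] nn_integral_count_space_finite)
  finally show ?thesis .
qed

theorem strong_law_iid_pmf:
  fixes q :: "'a pmf" and F :: "'a \<Rightarrow> real"
  assumes nonneg: "\<And>x. 0 \<le> F x" and sq: "integrable q (\<lambda>x. (F x)\<^sup>2)"
  shows "AE w in PiM UNIV (\<lambda>_::nat. measure_pmf q).
    (\<lambda>n. (\<Sum>i<n. F (w i)) / real n) \<longlonglongrightarrow> measure_pmf.expectation q F"
proof -
  let ?P = "PiM UNIV (\<lambda>_::nat. measure_pmf q)"
  define m where "m = measure_pmf.expectation q F"
  interpret P: prob_space ?P
    by (rule prob_space_PiM) (rule measure_pmf.prob_space_axioms)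
  have int_F: "integrable q F"
    by (rule measure_pmf.square_integrable_imp_integrable[OF _ sq]) simp
  have comp: "distr ?P (measure_pmf q) (\<lambda>w. w i) = measure_pmf q" for i
    by (rule distr_PiM_component) (rule measure_pmf.prob_space_axioms, simp)
  have meas: "(\<lambda>w. w i) \<in> ?P \<rightarrow>\<^sub>M measure_pmf q" for i
    by (rule measurable_component_singleton) simp
  have integral_comp: "P.expectation (\<lambda>w. g (w i)) = measure_pmf.expectation q g" for g :: "'a \<Rightarrow> real" and i
    using integral_distr[OF meas, of g i] by (simp add: comp)
  have integrable_comp: "integrable ?P (\<lambda>w. g (w i)) \<longleftrightarrow> integrable q g" for g :: "'a \<Rightarrow> real" and i
    using integrable_distr_eq[OF meas, of g i] by (simp add: comp)
  have "P.indep_vars (\<lambda>_. measure_pmf q) (\<lambda>i w. w i) UNIV"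
    using meas by (subst P.indep_vars_iff_distr_eq_PiM) (simp_all add: comp restrict_UNIV)
  then have indep: "P.indep_vars (\<lambda>_. borel) (\<lambda>i w. F (w i) - m) J" for J
    by (intro P.indep_vars_subset[OF P.indep_vars_compose2[where Y="\<lambda>_ x. F x - m"]]) auto
  have sq_m: "integrable q (\<lambda>x. (F x - m)\<^sup>2)"
    unfolding power2_diff using sq int_F by auto
  have int_m: "integrable q (\<lambda>x. F x - m)" using int_F by simp
  have mean: "measure_pmf.expectation q (\<lambda>x. F x - m) = 0"
    using int_F by (simp add: m_def)
  show ?thesis
    unfolding m_def[symmetric]
  proof (rule P.strong_law_nonneg_L2)
    show "P.expectation (\<lambda>w. (F (w i) - m)\<^sup>2) = measure_pmf.expectation q (\<lambda>x. (F x - m)\<^sup>2)" for i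
      by (rule integral_comp)
    \<comment> \<open>Puts the product of two centred coordinates into the shape of a finite product
      over an index set, as the lemmas on \<open>indep_vars\<close> require.\<close>
    have prod2: "(\<Prod>k\<in>{i, j}. F (w k) - m) = (F (w i) - m) * (F (w j) - m)" if "i \<noteq> j" for i j :: nat and w
      using that by simp
    show "integrable ?P (\<lambda>w. (F (w i) - m) * (F (w j) - m))" for i j
    proof (cases "i = j")
      case True
      then show ?thesis
        using integrable_comp[of "\<lambda>x. (F x - m)\<^sup>2" i] sq_m by (simp add: power2_eq_square)
    next
      case False
      have "integrable ?P (\<lambda>w. \<Prod>k\<in>{i, j}. F (w k) - m)"
        by (intro P.indep_vars_integrable indep) (simp_all add: integrable_comp[of "\<lambda>x. F x - m"] int_m)
      then show ?thesis by (simp only: prod2[OF False])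
    qed
    show "P.expectation (\<lambda>w. (F (w i) - m) * (F (w j) - m)) = 0" if "i \<noteq> j" for i j
    proof -
      have "P.expectation (\<lambda>w. \<Prod>k\<in>{i, j}. F (w k) - m) = (\<Prod>k\<in>{i, j}. P.expectation (\<lambda>w. F (w k) - m))"
        by (intro P.indep_vars_lebesgue_integral indep) (simp_all add: integrable_comp[of "\<lambda>x. F x - m"] int_m)
      also have "\<dots> = 0"
        using mean integral_comp[of "\<lambda>x. F x - m"] by (simp add: card_gt_0_iff)
      finally show ?thesis by (simp only: prod2[OF that])
    qed
  qed (rule nonneg)
qed

section \<open>Mean and second moment of the duration\<close>

context hv_environment begin

text \<open>At the origin \<open>exit_time\<close> is \<open>1 + a * b\<close>. The distances
  \<open>a\<close> and \<open>b\<close> are dependent, as they vanish together. Counting the pairs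
  \<open>i < a\<close>, \<open>j < b\<close> by indicators of runs avoids their joint law.\<close>

lemma suminf_stay_eq_runs:
  "AE w in M. (\<Sum>n. ennreal (stay (row w) n 0)) = 1 + (\<Sum>i. \<Sum>j. indicator (run i j) w)"
  using AE_row_interval
proof eventually_elim
  case (elim w)
  then obtain a b :: nat where gap: "{- int a<..<int b} \<subseteq> row w" "- int a \<notin> row w" "int b \<notin> row w"
    and run: "\<And>i j. w \<in> run i j \<longleftrightarrow> i < a \<and> j < b" by blast
  have "(\<Sum>n. ennreal (stay (row w) n 0)) = ennreal (exit_time (- int a) (int b) 0)"
    by (rule suminf_ennreal_eq[OF stay_nonneg stay_sums[OF gap]]) auto
  also have "\<dots> = 1 + ennreal (real a * real b)"
    unfolding exit_time_def[OF gap] by (simp add: ennreal_plus)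
  also have "ennreal (real a * real b) = (\<Sum>i. \<Sum>j. indicator (run i j) w)"
  proof -
    have "(\<Sum>j. indicator (run i j) w :: ennreal) = (if i < a then of_nat b else 0)" for i
    proof -
      have "(\<Sum>j. indicator (run i j) w :: ennreal) = (\<Sum>j\<in>{..<b}. indicator (run i j) w)"
        by (rule suminf_finite) (auto simp: indicator_def run)
      then show ?thesis by (simp add: indicator_def run)
    qed
    moreover have "(\<Sum>i. if i < a then of_nat b else 0 :: ennreal) = (\<Sum>i\<in>{..<a}. of_nat b)"
      by (subst suminf_finite[of "{..<a}"]) auto
    ultimately show ?thesis
      by (simp add: ennreal_mult ennreal_of_nat_eq_real_of_nat)
  qed
  finally show ?case .
qed

lemma nn_integral_run: "(\<integral>\<^sup>+w. indicator (run i j) w \<partial>M) = ennreal (p ^ Suc (i + j))"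
  by (simp add: emeasure_eq_measure prob_run del: power_Suc)

text \<open>Sums and integrals are exchanged in \<open>ennreal\<close>, where nonnegativity is
  enough. Summability of \<open>tail\<close> is then read off from the finite value of the double
  geometric series.\<close>

lemma tail_sums: "tail sums (1 + p / (1 - p)\<^sup>2)"
proof -
  have geometric: "(\<Sum>j. ennreal (c * p ^ j)) = ennreal (c / (1 - p))" if "0 \<le> c" for c
    using sums_mult[OF geometric_sums[of p], of c] p_pos p_less_1 that
    by (intro suminf_ennreal_eq) auto
  have "(\<Sum>n. ennreal (tail n)) = (\<integral>\<^sup>+w. (\<Sum>n. ennreal (stay (row w) n 0)) \<partial>M)"
    by (simp add: nn_integral_suminf nn_integral_stay)
  also have "\<dots> = (\<integral>\<^sup>+w. 1 + (\<Sum>i. \<Sum>j. indicator (run i j) w) \<partial>M)"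
    by (rule nn_integral_cong_AE[OF suminf_stay_eq_runs])
  also have "\<dots> = 1 + (\<Sum>i. \<Sum>j. ennreal (p ^ Suc (i + j)))"
    by (subst nn_integral_add)
       (simp_all add: nn_integral_suminf nn_integral_run emeasure_space_1 del: power_Suc)
  also have "(\<Sum>i. \<Sum>j. ennreal (p ^ Suc (i + j))) = (\<Sum>i. ennreal (p / (1 - p) * p ^ i))"
  proof (intro suminf_cong)
    fix i
    have "(\<Sum>j. ennreal (p ^ Suc (i + j))) = (\<Sum>j. ennreal (p ^ Suc i * p ^ j))"
      by (simp add: power_add mult.assoc)
    also have "\<dots> = ennreal (p ^ Suc i / (1 - p))"
      by (rule geometric) (use p_pos in simp)
    also have "p ^ Suc i / (1 - p) = p / (1 - p) * p ^ i"
      by simp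
    finally show "(\<Sum>j. ennreal (p ^ Suc (i + j))) = ennreal (p / (1 - p) * p ^ i)" .
  qed
  also have "\<dots> = ennreal (p / (1 - p) / (1 - p))"
    by (rule geometric) (use p_pos p_less_1 in simp)
  also have "p / (1 - p) / (1 - p) = p / (1 - p)\<^sup>2"
    by (simp add: power2_eq_square)
  also have "1 + ennreal (p / (1 - p)\<^sup>2) = ennreal (1 + p / (1 - p)\<^sup>2)"
    using p_pos by (simp add: ennreal_plus)
  finally have *: "(\<Sum>n. ennreal (tail n)) = ennreal (1 + p / (1 - p)\<^sup>2)" .
  have sum: "summable tail" by (rule summable_suminf_not_top) (simp_all add: *)
  have "ennreal (suminf tail) = ennreal (1 + p / (1 - p)\<^sup>2)"
    unfolding *[symmetric] by (rule suminf_ennreal2[symmetric, OF nonneg(3) sum])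
  moreover have "0 \<le> 1 + p / (1 - p)\<^sup>2" using p_pos by simp
  ultimately have "suminf tail = 1 + p / (1 - p)\<^sup>2"
    using ennreal_inj[OF suminf_nonneg[OF sum nonneg(3)]] by blast
  with sum show ?thesis by (simp add: sums_iff)
qed

text \<open>The interval has length \<open>a + b\<close>, so the weighted sum is at most
  \<open>?C\<close> times the exit time and hence at most \<open>?C\<close> squared. The constants
  come from \<open>(a + b)^2 \<le> 2 * a^2 + 2 * b^2\<close> and \<open>square_sum3_le\<close>,
  which give \<open>3 * (1 + 4 * a^4 + 4 * b^4)\<close>.\<close>

lemma suminf_stay_weighted_le:
  "AE w in M. (\<Sum>n. ennreal (real (Suc n) * stay (row w) n 0)) \<le>
     3 + 12 * (\<Sum>i. ennreal (real (Suc i) ^ 4) * indicator (run i 0) w)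
       + 12 * (\<Sum>i. ennreal (real (Suc i) ^ 4) * indicator (run 0 i) w)"
  using AE_row_interval
proof eventually_elim
  case (elim w)
  then obtain a b :: nat where gap: "{- int a<..<int b} \<subseteq> row w" "- int a \<notin> row w" "int b \<notin> row w"
    and run: "\<And>i j. w \<in> run i j \<longleftrightarrow> i < a \<and> j < b" and zero: "a = 0 \<longleftrightarrow> b = 0" by blast
  let ?C = "1 + (real a + real b)\<^sup>2"
  have C: "?C\<^sup>2 \<le> 3 + 12 * real a ^ 4 + 12 * real b ^ 4"
  proof -
    have sq: "(real a + real b)\<^sup>2 \<le> 2 * (real a)\<^sup>2 + 2 * (real b)\<^sup>2"
      using zero_le_power2[of "real a - real b"] by (simp add: power2_sum power2_diff)
    have "?C\<^sup>2 \<le> (1 + 2 * (real a)\<^sup>2 + 2 * (real b)\<^sup>2)\<^sup>2"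
      using sq by (intro power_mono) auto
    also have "\<dots> \<le> 3 * (1\<^sup>2 + (2 * (real a)\<^sup>2)\<^sup>2 + (2 * (real b)\<^sup>2)\<^sup>2)"
      by (rule square_sum3_le)
    also have "\<dots> = 3 + 12 * real a ^ 4 + 12 * real b ^ 4"
      by (simp add: power_mult_distrib power_mult[symmetric])
    finally show ?thesis .
  qed
  have partial: "(\<Sum>n<N. real (Suc n) * stay (row w) n 0) \<le> ?C\<^sup>2" for N
  proof -
    have "(\<Sum>n<N. real (Suc n) * stay (row w) n 0) \<le> ?C * exit_time (- int a) (int b) 0"
      using sum_stay_weighted_le[OF gap, of 0 N] by (simp add: add.commute)
    also have "\<dots> \<le> ?C * ?C"
      using exit_time_le(2)[OF gap, of 0] by (intro mult_left_mono) (auto simp: add.commute)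
    finally show ?thesis by (simp add: power2_eq_square)
  qed
  have "(\<Sum>n. ennreal (real (Suc n) * stay (row w) n 0)) \<le> ennreal (3 + 12 * real a ^ 4 + 12 * real b ^ 4)"
  proof (rule suminf_le_const)
    fix N
    have "(\<Sum>n<N. ennreal (real (Suc n) * stay (row w) n 0)) = ennreal (\<Sum>n<N. real (Suc n) * stay (row w) n 0)"
      by (rule sum_ennreal) (simp add: stay_nonneg)
    also have "\<dots> \<le> ennreal (3 + 12 * real a ^ 4 + 12 * real b ^ 4)"
      using partial[of N] C by (intro ennreal_leI) linarith
    finally show "(\<Sum>n<N. ennreal (real (Suc n) * stay (row w) n 0)) \<le> \<dots>" .
  qed simp
  also have "\<dots> = 3 + 12 * ennreal (real a ^ 4) + 12 * ennreal (real b ^ 4)"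
    by (simp add: ennreal_plus ennreal_mult')
  also have "\<dots> \<le> 3 + 12 * (\<Sum>i. ennreal (real (Suc i) ^ 4) * indicator (run i 0) w)
       + 12 * (\<Sum>i. ennreal (real (Suc i) ^ 4) * indicator (run 0 i) w)"
    using zero run
    by (intro add_mono mult_left_mono fourth_power_le_suminf order_refl) (auto simp: indicator_def)
  finally show ?case .
qed

text \<open>In substance the finite second moment of the duration. Averaging the quenched bound
  leaves series of \<open>(i + 1)^4 * p^(i + 1)\<close>.\<close>

lemma summable_weighted_tail: "summable (\<lambda>n. real (Suc n) * tail n)"
proof (rule summable_suminf_not_top)
  let ?R = "\<Sum>i. ennreal (real (Suc i) ^ 4 * p ^ Suc i)"
  have "?R = ennreal (\<Sum>i. real (Suc i) ^ 4 * p ^ Suc i)"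
    using p_pos p_less_1 by (intro suminf_ennreal2 summable_fourth_power_times_geometric) simp_all
  then have R: "?R < \<top>" by simp
  have moment: "(\<integral>\<^sup>+w. (\<Sum>i. ennreal (real (Suc i) ^ 4) * indicator (A i) w) \<partial>M) = ?R"
    if "\<And>i. A i \<in> sets M" "\<And>i. prob (A i) = p ^ Suc i" for A
    using that p_pos
    by (simp add: nn_integral_suminf nn_integral_cmult emeasure_eq_measure ennreal_mult del: power_Suc of_nat_Suc)
  have "(\<Sum>n. ennreal (real (Suc n) * tail n)) =
      (\<Sum>n. \<integral>\<^sup>+w. ennreal (real (Suc n) * stay (row w) n 0) \<partial>M)"
    by (simp add: ennreal_mult' nn_integral_cmult nn_integral_stay del: of_nat_Suc)
  also have "\<dots> = (\<integral>\<^sup>+w. (\<Sum>n. ennreal (real (Suc n) * stay (row w) n 0)) \<partial>M)"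
    by (rule nn_integral_suminf[symmetric]) simp
  also have "\<dots> \<le> (\<integral>\<^sup>+w. 3 + 12 * (\<Sum>i. ennreal (real (Suc i) ^ 4) * indicator (run i 0) w)
       + 12 * (\<Sum>i. ennreal (real (Suc i) ^ 4) * indicator (run 0 i) w) \<partial>M)"
    by (rule nn_integral_mono_AE[OF suminf_stay_weighted_le])
  also have "\<dots> = 3 + 12 * ?R + 12 * ?R"
    by (simp add: nn_integral_add nn_integral_cmult emeasure_space_1 moment prob_run del: power_Suc of_nat_Suc)
  also have "\<dots> < \<top>"
    using R by (simp add: ennreal_mult_less_top)
  finally show "(\<Sum>n. ennreal (real (Suc n) * tail n)) \<noteq> \<top>"
    by simp
qed simp

section \<open>The excursion weights as a probability law\<close>

lemma tail_tendsto_0: "tail \<longlonglongrightarrow> 0"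
  using summable_LIMSEQ_zero sums_summable[OF tail_sums] by blast

text \<open>Iterates \<open>prefix_weight_split\<close>: after \<open>l\<close> the row is left
  after fewer than \<open>n\<close> further horizontal steps, or at least \<open>n\<close> more are
  made.\<close>

lemma prefix_weight_expand:
  "prefix_weight l = (\<Sum>k<n. \<Sum>m\<in>lists_of_length k. excursion_weight (l @ m))
     + (\<Sum>m\<in>lists_of_length n. prefix_weight (l @ m))"
proof (induction n)
  case (Suc n)
  have "(\<Sum>m\<in>lists_of_length n. prefix_weight (l @ m)) =
      (\<Sum>m\<in>lists_of_length n. excursion_weight (l @ m)) + (\<Sum>m\<in>lists_of_length (Suc n). prefix_weight (l @ m))"
    unfolding sum_lists_Suc_snoc sum.distrib[symmetric]
    by (intro sum.cong refl) (subst prefix_weight_split, simp)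
  with Suc show ?case by simp
qed simp

text \<open>The remainder in \<open>prefix_weight_expand\<close> is part of the sum defining
  \<open>tail (n + length l)\<close> and tends to 0, so no mass is lost to walks that stay in the
  row forever.\<close>

lemma excursion_weight_sums:
  "(\<lambda>n. \<Sum>m\<in>lists_of_length n. excursion_weight (l @ m)) sums prefix_weight l"
proof -
  have le: "(\<Sum>m\<in>lists_of_length n. prefix_weight (l @ m)) \<le> tail (n + length l)" for n
  proof -
    have "(\<Sum>m\<in>lists_of_length n. prefix_weight (l @ m)) = sum prefix_weight ((@) l ` lists_of_length n)"
      by (subst sum.reindex) (auto simp: inj_on_def)
    also have "\<dots> \<le> tail (n + length l)"
      unfolding tail_def by (intro sum_mono2) auto
    finally show ?thesis .
  qed
  have "(\<lambda>n. \<Sum>m\<in>lists_of_length n. prefix_weight (l @ m)) \<longlonglongrightarrow> 0"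
    by (rule tendsto_sandwich[OF _ _ tendsto_const LIMSEQ_ignore_initial_segment[OF tail_tendsto_0, of "length l"]])
       (auto intro!: always_eventually le sum_nonneg)
  from tendsto_diff[OF tendsto_const[of "prefix_weight l"] this]
  have lim: "(\<lambda>n. prefix_weight l - (\<Sum>m\<in>lists_of_length n. prefix_weight (l @ m))) \<longlonglongrightarrow> prefix_weight l"
    by simp
  show ?thesis
  proof -
    have "prefix_weight l - (\<Sum>m\<in>lists_of_length n. prefix_weight (l @ m)) =
        (\<Sum>k<n. \<Sum>m\<in>lists_of_length k. excursion_weight (l @ m))" for n
      using prefix_weight_expand[of l n] by linarith
    with lim show ?thesis by (simp add: sums_def)
  qed
qed

lemma nn_integral_excursion_weight:
  "(\<integral>\<^sup>+m. ennreal (excursion_weight (l @ m)) \<partial>count_space UNIV) = ennreal (prefix_weight l)"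
proof -
  have "(\<integral>\<^sup>+m. ennreal (excursion_weight (l @ m)) \<partial>count_space UNIV) =
      (\<Sum>n. ennreal (\<Sum>m\<in>lists_of_length n. excursion_weight (l @ m)))"
    unfolding nn_integral_lists_of_length by (intro suminf_cong sum_ennreal nonneg)
  also have "\<dots> = ennreal (prefix_weight l)"
    by (rule suminf_ennreal_eq[OF _ excursion_weight_sums]) (intro sum_nonneg nonneg)
  finally show ?thesis .
qed

definition excursion_pmf :: "bool list pmf" where
  "excursion_pmf = embed_pmf excursion_weight"

text \<open>The total mass is \<open>prefix_weight []\<close>, the weight of the empty path, which
  is 1.\<close>

lemma pmf_excursion_pmf: "pmf excursion_pmf l = excursion_weight l"
  unfolding excursion_pmf_def
proof (rule pmf_embed_pmf)
  show "(\<integral>\<^sup>+l. ennreal (excursion_weight l) \<partial>count_space UNIV) = 1"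
    using nn_integral_excursion_weight[of "[]"]
    by (simp add: prefix_weight_def weight_def horizontal_count_def pattern_prob_def)
qed simp

lemma emeasure_excursion_prefix:
  "emeasure excursion_pmf {l'. \<exists>m. l' = l @ m} = ennreal (prefix_weight l)"
proof -
  have "bij_betw ((@) l) UNIV {l'. \<exists>m. l' = l @ m}" by (auto simp: bij_betw_def inj_on_def)
  from nn_integral_bij_count_space[OF this, of "\<lambda>l. ennreal (pmf excursion_pmf l)"]
  show ?thesis
    by (simp add: nn_integral_pmf) (simp add: pmf_excursion_pmf nn_integral_excursion_weight)
qed

lemma emeasure_excursion_length: "emeasure excursion_pmf {l. n \<le> length l} = ennreal (tail n)"
proof -
  have "{l :: bool list. n \<le> length l} = (\<Union>l\<in>lists_of_length n. {l'. \<exists>m. l' = l @ m})"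
  proof safe
    fix l :: "bool list" assume "n \<le> length l"
    then show "l \<in> (\<Union>l\<in>lists_of_length n. {l'. \<exists>m. l' = l @ m})"
      by (intro UN_I[of "take n l"]) (auto intro!: exI[of _ "drop n l"])
  qed auto
  also have "emeasure excursion_pmf \<dots> = (\<Sum>l\<in>lists_of_length n. emeasure excursion_pmf {l'. \<exists>m. l' = l @ m})"
    by (rule sum_emeasure[symmetric]) (auto simp: disjoint_family_on_def)
  finally show ?thesis
    by (simp add: emeasure_excursion_prefix tail_def sum_ennreal)
qed

lemma excursion_time:
  "integrable excursion_pmf (\<lambda>l. real (Suc (length l)))"
  "measure_pmf.expectation excursion_pmf (\<lambda>l. real (Suc (length l))) = 1 + p / (1 - p)\<^sup>2"
proof -
  have "(\<integral>\<^sup>+l. of_nat (Suc (length l)) \<partial>excursion_pmf) = (\<Sum>n. ennreal (tail n))"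
    \<comment> \<open>Tail-sum formula for the mean: the duration \<open>Suc (length l)\<close>
      exceeds \<open>n\<close> exactly when \<open>n \<le> length l\<close>.\<close>
    by (subst nn_integral_nat_function) (simp_all add: less_Suc_eq_le emeasure_excursion_length)
  also have "\<dots> = ennreal (1 + p / (1 - p)\<^sup>2)"
    by (intro suminf_ennreal_eq tail_sums) simp
  finally have "has_bochner_integral excursion_pmf (\<lambda>l. real (Suc (length l))) (1 + p / (1 - p)\<^sup>2)"
    using p_pos
    by (intro has_bochner_integral_nn_integral) (simp_all add: ennreal_of_nat_eq_real_of_nat)
  then show "integrable excursion_pmf (\<lambda>l. real (Suc (length l)))"
    "measure_pmf.expectation excursion_pmf (\<lambda>l. real (Suc (length l))) = 1 + p / (1 - p)\<^sup>2"
    by (auto simp: has_bochner_integral_iff)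
qed

text \<open>The tail-sum method for the square: \<open>(n + 1)^2\<close> is at most the sum of
  \<open>2 * (k + 1)\<close> over \<open>k \<le> n\<close>, which reduces the claim to
  \<open>summable_weighted_tail\<close>.\<close>

lemma square_integrable_excursion_time: "integrable excursion_pmf (\<lambda>l. (real (Suc (length l)))\<^sup>2)"
proof (rule integrableI_bounded)
  have gauss: "(real (Suc n))\<^sup>2 \<le> (\<Sum>k<Suc n. 2 * real (Suc k))" for n
    by (induction n) (auto simp: power2_eq_square algebra_simps)
  have "ennreal ((real (Suc (length l)))\<^sup>2) \<le> (\<Sum>n. ennreal (2 * real (Suc n)) * indicator {l. n \<le> length l} l)" for l
  proof -
    have "ennreal ((real (Suc (length l)))\<^sup>2) \<le> (\<Sum>k<Suc (length l). ennreal (2 * real (Suc k)))"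
      using gauss[of "length l"] by (simp add: sum_ennreal ennreal_leI del: sum.lessThan_Suc of_nat_Suc)
    also have "\<dots> = (\<Sum>k<Suc (length l). ennreal (2 * real (Suc k)) * indicator {l. k \<le> length l} l)"
      by (intro sum.cong) auto
    also have "\<dots> \<le> (\<Sum>n. ennreal (2 * real (Suc n)) * indicator {l. n \<le> length l} l)"
      by (rule sum_le_suminf) auto
    finally show ?thesis .
  qed
  then have "(\<integral>\<^sup>+l. ennreal (norm ((real (Suc (length l)))\<^sup>2)) \<partial>excursion_pmf) \<le>
      (\<integral>\<^sup>+l. (\<Sum>n. ennreal (2 * real (Suc n)) * indicator {l. n \<le> length l} l) \<partial>excursion_pmf)"
    by (intro nn_integral_mono) simp
  also have "\<dots> = (\<Sum>n. ennreal (2 * (real (Suc n) * tail n)))"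
    by (simp add: nn_integral_suminf nn_integral_cmult emeasure_excursion_length ennreal_mult'[symmetric] mult_ac del: of_nat_Suc)
  also have "\<dots> < \<infinity>"
    by (subst suminf_ennreal2[OF _ summable_mult[OF summable_weighted_tail]]) auto
  finally show "(\<integral>\<^sup>+l. ennreal (norm ((real (Suc (length l)))\<^sup>2)) \<partial>excursion_pmf) < \<infinity>" .
qed simp

lemma map_excursion_pmf_flip: "map_pmf (map Not) excursion_pmf = excursion_pmf"
proof (rule pmf_eqI)
  fix l
  have inj: "inj (map Not)" by (intro inj_mapI) (simp add: inj_def)
  have "pmf (map_pmf (map Not) excursion_pmf) (map Not (map Not l)) = pmf excursion_pmf (map Not l)"
    by (rule pmf_map_inj'[OF inj])
  moreover have "map Not (map Not l) = l" by (simp add: comp_def)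
  moreover have "excursion_weight (map Not l) = excursion_weight l"
    using weight_mirror[of "map Some l @ [None]"] by (simp add: excursion_weight_def comp_def)
  ultimately show "pmf (map_pmf (map Not) excursion_pmf) l = pmf excursion_pmf l"
    by (simp add: pmf_excursion_pmf)
qed

lemma expectation_drift: "measure_pmf.expectation excursion_pmf (\<lambda>l. real_of_int (drift l)) = 0"
proof -
  have "measure_pmf.expectation excursion_pmf (\<lambda>l. real_of_int (drift l)) =
      measure_pmf.expectation (map_pmf (map Not) excursion_pmf) (\<lambda>l. real_of_int (drift l))"
    by (simp only: map_excursion_pmf_flip)
  also have "\<dots> = - measure_pmf.expectation excursion_pmf (\<lambda>l. real_of_int (drift l))"
    by simp
  finally show ?thesis by simp
qed

section \<open>The annealed walk as a sequence of independent excursions\<close>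

abbreviation excursions :: "(nat \<Rightarrow> bool list) measure" where
  "excursions \<equiv> PiM UNIV (\<lambda>_. measure_pmf excursion_pmf)"

lemma sets_excursions: "sets excursions = sets path_space"
  by (intro sets_PiM_cong) auto

lemma measurable_walk_excursions: "(\<lambda>w n. walk n w) \<in> excursions \<rightarrow>\<^sub>M path_space"
  using measurable_walk_path by (simp add: measurable_cong_sets[OF sets_excursions refl])

lemma abs_drift_le_time: "\<bar>real_of_int (drift l)\<bar> \<le> real (Suc (length l))"
  using abs_drift_le[of l] by simp

text \<open>The strong law at hand is for nonnegative variables, and the drift is signed. It is
  applied to duration plus drift, which lies between 0 and twice the duration; subtracting the law
  for the duration leaves the drift.\<close>

lemma AE_walk_speed:
  "AE w in excursions. (\<lambda>n. inverse (real n) *\<^sub>R plane (walk n w)) \<longlonglongrightarrow> (0, (1 - p)\<^sup>2 / (p + (1 - p)\<^sup>2))"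
proof -
  let ?T = "\<lambda>l. real (Suc (length l))" and ?D = "\<lambda>l. real_of_int (drift l)"
  let ?\<mu> = "1 + p / (1 - p)\<^sup>2"
  have int_D: "integrable excursion_pmf ?D"
    by (rule Bochner_Integration.integrable_bound[OF excursion_time(1)])
       (use abs_drift_le_time in auto)
  have bounds: "0 \<le> ?T l + ?D l" "?D l \<le> ?T l" for l
    using abs_drift_le_time[of l] by (simp_all only: abs_le_iff) simp_all
  have "integrable excursion_pmf (\<lambda>l. (?T l + ?D l)\<^sup>2)"
  proof (rule Bochner_Integration.integrable_bound)
    show "integrable excursion_pmf (\<lambda>l. 4 * (?T l)\<^sup>2)"
      by (intro integrable_mult_right square_integrable_excursion_time)
    have "(?T l + ?D l)\<^sup>2 \<le> 4 * (?T l)\<^sup>2" for l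
    proof -
      have "(?T l + ?D l)\<^sup>2 \<le> (2 * ?T l)\<^sup>2"
        using bounds[of l] by (intro power_mono) simp_all
      then show ?thesis by (simp add: power_mult_distrib del: of_nat_Suc)
    qed
    then show "AE l in excursion_pmf. norm ((?T l + ?D l)\<^sup>2) \<le> norm (4 * (?T l)\<^sup>2)"
      by (simp del: of_nat_Suc)
  qed simp
  moreover have "0 \<le> ?T l + ?D l" for l
    using bounds[of l] by simp
  ultimately have "AE w in excursions. (\<lambda>n. (\<Sum>i<n. ?T (w i) + ?D (w i)) / real n) \<longlonglongrightarrow>
      measure_pmf.expectation excursion_pmf (\<lambda>l. ?T l + ?D l)"
    by (intro strong_law_iid_pmf)
  moreover have "measure_pmf.expectation excursion_pmf (\<lambda>l. ?T l + ?D l) = ?\<mu>"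
    by (subst Bochner_Integration.integral_add[OF excursion_time(1) int_D])
       (simp only: excursion_time(2) expectation_drift add_0_right)
  ultimately have TD: "AE w in excursions. (\<lambda>n. (\<Sum>i<n. ?T (w i) + ?D (w i)) / real n) \<longlonglongrightarrow> ?\<mu>"
    by (simp only:)
  have T: "AE w in excursions. (\<lambda>n. (\<Sum>i<n. ?T (w i)) / real n) \<longlonglongrightarrow> ?\<mu>"
    using strong_law_iid_pmf[of ?T, OF _ square_integrable_excursion_time]
    by (simp only: excursion_time(2) of_nat_0_le_iff)
  from T TD show ?thesis
  proof eventually_elim
    case (elim w)
    have "(\<lambda>n. (\<Sum>i<n. ?T (w i) + ?D (w i)) / real n - (\<Sum>i<n. ?T (w i)) / real n) \<longlonglongrightarrow> ?\<mu> - ?\<mu>"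
      by (intro tendsto_diff elim)
    then have D: "(\<lambda>n. (\<Sum>i<n. ?D (w i)) / real n) \<longlonglongrightarrow> 0"
      by (simp add: sum.distrib add_divide_distrib)
    have "0 < ?\<mu>" using p_pos by (simp add: add_pos_nonneg)
    moreover have "inverse ?\<mu> = (1 - p)\<^sup>2 / (p + (1 - p)\<^sup>2)"
      using p_less_1 by (simp add: field_simps)
    ultimately show ?case
      using walk_asymptotics[OF elim(1) D] by simp
  qed
qed

text \<open>Induction on the word, removing its first completed excursion: the product measure and
  \<open>weight\<close> factor in the same way. A word without \<open>None\<close> is a prefix event
  for the first coordinate.\<close>

lemma emeasure_emits:
  "emeasure excursions {w. emits ms w} = ennreal (weight ms)"
proof (induction "length ms" arbitrary: ms rule: less_induct)
  case less
  interpret sequence_space "measure_pmf excursion_pmf"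
    by (intro sequence_space.intro product_prob_spaceI measure_pmf.prob_space_axioms)
  have emits_sets: "{w. emits ms w} \<in> sets excursions" for ms
  proof -
    have "{w. \<forall>i\<le>length ms. walk i w = site ms i} \<in> sets path_space"
      using measurable_sets[OF measurable_walk_path sets_cylinder[of "length ms" "site ms"]]
      by (simp add: vimage_def space_PiM)
    then show ?thesis unfolding sets_excursions walk_eq_site_iff_emits .
  qed
  show ?case
  proof (cases "None \<in> set ms")
    case False
    then have "\<exists>l. ms = map Some l" unfolding ex_map_conv by (metis not_None_eq)
    then obtain l where ms: "ms = map Some l" ..
    have "emeasure excursions {w. emits ms w} =
        emeasure (distr excursions (measure_pmf excursion_pmf) (\<lambda>w. w 0)) {l'. \<exists>m. l' = l @ m}"
      unfolding ms emits_horizontal_iff by (subst emeasure_distr) (auto simp: vimage_def space_PiM)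
    also have "distr excursions (measure_pmf excursion_pmf) (\<lambda>w. w 0) = measure_pmf excursion_pmf"
      by (rule distr_PiM_component) (auto intro: measure_pmf.prob_space_axioms)
    finally show ?thesis by (simp add: emeasure_excursion_prefix ms prefix_weight_def)
  next
    case True
    then obtain ys zs where split: "ms = ys @ None # zs" "None \<notin> set ys"
      by (auto dest: split_list_first)
    then have "\<exists>l. ys = map Some l" unfolding ex_map_conv by (metis not_None_eq)
    then obtain l where "ys = map Some l" ..
    with split have ms: "ms = map Some l @ None # zs" by simp
    have pre: "(\<lambda>(s, w). case_nat s w) -` {w. emits ms w} \<inter> space (measure_pmf excursion_pmf \<Otimes>\<^sub>M S) =
        {l} \<times> {w. emits zs w}"
      by (auto simp: ms emits_excursion_iff space_pair_measure space_PiM)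
    \<comment> \<open>The sequence is split into its first coordinate and the shifted rest, which is
      again distributed as \<open>excursions\<close>.\<close>
    have "emeasure excursions {w. emits ms w} =
        emeasure (distr (measure_pmf excursion_pmf \<Otimes>\<^sub>M S) S (\<lambda>(s, w). case_nat s w)) {w. emits ms w}"
      by (simp only: PiM_iter)
    also have "\<dots> = emeasure (measure_pmf excursion_pmf \<Otimes>\<^sub>M S) ({l} \<times> {w. emits zs w})"
      unfolding pre[symmetric] by (rule emeasure_distr) (use emits_sets in measurable)
    also have "\<dots> = emeasure (measure_pmf excursion_pmf) {l} * emeasure S {w. emits zs w}"
      by (rule P.emeasure_pair_measure_Times) (auto intro: emits_sets)
    also have "\<dots> = ennreal (weight ms)"
      using less[of zs]
      by (simp add: ms emeasure_pmf_single pmf_excursion_pmf weight_excursion[of l zs]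
          ennreal_mult[symmetric] weight_nonneg excursion_weight_def)
    finally show ?thesis .
  qed
qed

lemma cylinder_cases:
  fixes y :: "nat \<Rightarrow> int \<times> int"
  assumes "y 0 = 0" "\<And>i. i < n \<Longrightarrow> y (Suc i) - y i \<in> range move"
  obtains ms where "length ms = n" "\<And>i. i \<le> n \<Longrightarrow> y i = site ms i"
proof -
  have "\<forall>i\<in>{..<n}. \<exists>m. y (Suc i) - y i = move m"
    using assms(2) by blast
  then obtain f where f: "\<And>i. i < n \<Longrightarrow> y (Suc i) - y i = move (f i)"
    unfolding bchoice_iff by blast
  define ms where "ms = map f [0..<n]"
  have "y i = site ms i" if "i \<le> n" for i
    using that
  proof (induction i)
    case (Suc i)
    then have "site ms (Suc i) = site ms i + move (f i)"
      by (simp add: site_def ms_def take_map take_upt)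
    with Suc f[of i] show ?case by (simp add: algebra_simps)
  qed (simp add: assms(1))
  with that[of ms] show ?thesis by (simp add: ms_def)
qed

text \<open>Cylinders form an intersection-stable generator, so it is enough to compare them. If the
  prescribed path starts at 0 and makes only steps in \<open>range move\<close>, both sides equal
  \<open>weight ms\<close>; all other cylinders have measure 0 on both sides.\<close>

lemma annealed_law_eq_distr_walk:
  "distr excursions path_space (\<lambda>w n. walk n w) = annealed_law M G"
proof (rule measure_eqI_generator_eq_countable)
  let ?G = "insert {} (range (\<lambda>(n, y). {X. \<forall>i\<le>n. X i = y i})) :: (nat \<Rightarrow> int \<times> int) set set"
  let ?D = "distr excursions path_space (\<lambda>w n. walk n w)"
  note meas = measurable_walk_excursions
  interpret A: prob_space "annealed_law M G" by (rule prob_space_annealed_law[OF iid])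
  interpret E: prob_space excursions by (rule prob_space_PiM) (rule measure_pmf.prob_space_axioms)
  interpret D: prob_space ?D by (rule E.prob_space_distr[OF meas])
  show "Int_stable ?G" by (rule sets_path_space_generated(2))
  show "?G \<subseteq> Pow UNIV" by simp
  show "sets ?D = sigma_sets UNIV ?G"
    by (simp add: sets_path_space_generated(1))
  show "sets (annealed_law M G) = sigma_sets UNIV ?G"
    unfolding sets_annealed_law[OF iid] by (rule sets_path_space_generated(1))
  show "range (\<lambda>y. {X. \<forall>i\<le>0. X i = y i}) \<subseteq> ?G" by auto
  show "\<Union> (range (\<lambda>y :: nat \<Rightarrow> int \<times> int. {X. \<forall>i\<le>0. X i = y i})) = UNIV" by auto
  show "countable (range (\<lambda>y :: nat \<Rightarrow> int \<times> int. {X. \<forall>i\<le>0. X i = y i}))"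
  proof -
    have "range (\<lambda>y :: nat \<Rightarrow> int \<times> int. {X. \<forall>i\<le>0. X i = y i}) \<subseteq> range (\<lambda>x. {X. X 0 = x})" by auto
    then show ?thesis by (rule countable_subset) simp
  qed
  show "emeasure ?D a \<noteq> \<infinity>" for a by simp
  fix X assume "X \<in> ?G"
  then consider "X = {}" | n y where "X = {X. \<forall>i\<le>n. X i = y i}" by auto
  then show "emeasure ?D X = emeasure (annealed_law M G) X"
  proof cases
    case (2 n y)
    have D: "emeasure ?D X = emeasure excursions {w. \<forall>i\<le>n. walk i w = y i}"
      unfolding 2 by (subst emeasure_distr[OF meas]) (auto simp: vimage_def space_PiM)
    show ?thesis
    proof (cases "y 0 = 0 \<and> (\<forall>i<n. y (Suc i) - y i \<in> range move)")
      case True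
      then obtain ms where ms: "length ms = n" "\<And>i. i \<le> n \<Longrightarrow> y i = site ms i"
        using cylinder_cases[of y n] by blast
      have "emeasure ?D X = emeasure excursions {w. \<forall>i\<le>length ms. walk i w = site ms i}"
        unfolding D using ms by (intro arg_cong2[where f=emeasure]) auto
      also have "\<dots> = emeasure (annealed_law M G) {X. \<forall>i\<le>length ms. X i = site ms i}"
        unfolding walk_eq_site_iff_emits emeasure_emits annealed_law_cylinder ..
      also have "\<dots> = emeasure (annealed_law M G) X"
        unfolding 2 using ms by (intro arg_cong2[where f=emeasure]) auto
      finally show ?thesis .
    next
      case False
      have step: "walk (Suc i) w - walk i w \<in> range move" for i w
      proof (induction i arbitrary: w)
        case (Suc i)
        from Suc[of "advance w"] show ?case by simp
      qed simp
      have "{w. \<forall>i\<le>n. walk i w = y i} = {}"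
      proof (rule ccontr)
        assume "{w. \<forall>i\<le>n. walk i w = y i} \<noteq> {}"
        then obtain w where w: "\<And>i. i \<le> n \<Longrightarrow> walk i w = y i" by blast
        have "y 0 = 0" using w[of 0] by simp
        moreover have "y (Suc i) - y i \<in> range move" if "i < n" for i
          using step[of i w] w[of i] w[of "Suc i"] that by simp
        ultimately show False using False by blast
      qed
      then have "emeasure ?D X = 0" unfolding D by (simp only: emeasure_empty)
      moreover have "emeasure (annealed_law M G) X = 0"
      proof -
        \<comment> \<open>For almost every environment an inadmissible path has a wrong starting
          point or a step of probability 0, so its cylinder is null already under the quenched
          law.\<close>
        have "AE w in M. emeasure (quenched_law (\<lambda>x. G x w)) X = 0"
          using AE_hv_config
        proof eventually_elim
          case (elim w)
          show ?case
          proof (cases "y 0 = 0")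
            case True
            with False obtain i where i: "i < n" "y (Suc i) - y i \<notin> range move" by blast
            have "pmf (uniform_step (\<lambda>x. G x w) (y i)) (y (Suc i)) = 0"
              using pmf_uniform_step_non_move[OF elim i(2), of "y i"] by simp
            with i(1) have "(\<Prod>i<n. pmf (uniform_step (\<lambda>x. G x w) (y i)) (y (Suc i))) = 0"
              by (intro prod_zero) auto
            then show ?thesis
              unfolding 2 quenched_law_def emeasure_chain_law_cylinder
              by (simp only: mult_zero_right ennreal_0)
          next
            case False
            then show ?thesis
              unfolding 2 quenched_law_def emeasure_chain_law_cylinder by simp
          qed
        qed
        moreover have "X \<in> sets path_space" unfolding 2 by (rule sets_cylinder)
        ultimately show ?thesis
          by (simp add: emeasure_annealed_law[OF iid] nn_integral_cong_AE)
      qed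
      ultimately show ?thesis by simp
    qed
  qed simp
qed

text \<open>Countably many tolerances \<open>inverse (real (Suc k))\<close> describe the
  convergence, and each single inequality depends on one coordinate only.\<close>

lemma sets_tendsto_plane:
  "{X. (\<lambda>n. inverse (real n) *\<^sub>R plane (X n)) \<longlonglongrightarrow> v} \<in> sets path_space"
proof -
  have "{X \<in> space path_space. \<forall>k. \<exists>N. \<forall>n\<ge>N.
      dist (inverse (real n) *\<^sub>R plane (X n)) v < inverse (real (Suc k))} \<in> sets path_space"
  proof -
    have "{X \<in> space path_space. dist (inverse (real n) *\<^sub>R plane (X n)) v < inverse (real (Suc k))}
        \<in> sets path_space" for n k
      using measurable_sets[OF measurable_component_singleton[of n UNIV "\<lambda>_. count_space (UNIV :: (int \<times> int) set)"],
          of "{x. dist (inverse (real n) *\<^sub>R plane x) v < inverse (real (Suc k))}"]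
      by (simp add: vimage_def Int_def conj_commute)
    then show ?thesis by measurable
  qed
  moreover have "(\<lambda>n. inverse (real n) *\<^sub>R plane (X n)) \<longlonglongrightarrow> v \<longleftrightarrow>
      (\<forall>k. \<exists>N. \<forall>n\<ge>N. dist (inverse (real n) *\<^sub>R plane (X n)) v < inverse (real (Suc k)))" for X
    unfolding LIMSEQ_def
  proof safe
    fix k
    assume "\<forall>r>0. \<exists>no. \<forall>n\<ge>no. dist (inverse (real n) *\<^sub>R plane (X n)) v < r"
    then show "\<exists>N. \<forall>n\<ge>N. dist (inverse (real n) *\<^sub>R plane (X n)) v < inverse (real (Suc k))"
      by simp
  next
    fix r :: real
    assume *: "\<forall>k. \<exists>N. \<forall>n\<ge>N. dist (inverse (real n) *\<^sub>R plane (X n)) v < inverse (real (Suc k))" and "0 < r"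
    from reals_Archimedean[OF \<open>0 < r\<close>] obtain k where "inverse (real (Suc k)) < r" by blast
    with * show "\<exists>no. \<forall>n\<ge>no. dist (inverse (real n) *\<^sub>R plane (X n)) v < r"
      by (meson less_trans)
  qed
  ultimately show ?thesis by (simp add: space_PiM)
qed

end

theorem mainTheorem1:
  fixes p :: real
    and M :: "'w measure"
    and G :: "int \<times> int \<Rightarrow> 'w \<Rightarrow> (int \<times> int) set"
  assumes "0 < p" and "p < 1"
    and "iid_environment M G"
    and "\<And>x. measure M {w \<in> space M. G x w = {e1, - e1}} = p"
    and "\<And>x. measure M {w \<in> space M. G x w = {e2}} = 1 - p"
  shows "measure (annealed_law M G)
           {X. (\<lambda>n. inverse (real n) *\<^sub>R plane (X n)) \<longlonglongrightarrow> (0, (1 - p)\<^sup>2 / (p + (1 - p)\<^sup>2))} = 1"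
proof -
  interpret hv_environment p M G
    using assms by unfold_locales
  let ?A = "{X. (\<lambda>n. inverse (real n) *\<^sub>R plane (X n)) \<longlonglongrightarrow> (0, (1 - p)\<^sup>2 / (p + (1 - p)\<^sup>2))}"
  interpret A: prob_space "annealed_law M G" by (rule prob_space_annealed_law[OF iid])
  have "AE X in annealed_law M G. X \<in> ?A"
    unfolding annealed_law_eq_distr_walk[symmetric]
  proof (subst AE_distr_iff[OF measurable_walk_excursions])
    show "{X \<in> space path_space. X \<in> ?A} \<in> sets path_space"
      using sets_tendsto_plane by (simp add: space_PiM)
    show "AE w in excursions. (\<lambda>n. walk n w) \<in> ?A"
      using AE_walk_speed by simp
  qed
  moreover have "?A \<in> sets (annealed_law M G)"
    unfolding sets_annealed_law[OF iid] by (rule sets_tendsto_plane)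
  ultimately show ?thesis
    by (simp only: A.AE_in_set_eq_1)
qed

end
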